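(* Let $\mathfrak{g}$ be a $4$-dimensional real unimodular almost abelian Lie algebra. Then $\mathfrak{g}$ admits an inner product $\langle\cdot,\cdot\rangle$ such that $(\mathfrak{g},\langle\cdot,\cdot\rangle)$ carries a strict CKY $3$-form if and only if $\mathfrak{g}$ is isomorphic to one of the following Lie algebras: $\mathfrak{h}_3\times\mathbb{R}$, $\mathfrak{n}_4$, $\mathfrak{r}_{3,-1}\times\mathbb{R}$ or $\mathfrak{e}(2)\times\mathbb{R}$.
   Context: A real Lie algebra is almost abelian if it has an abelian ideal of codimension one, and unimodular if $\operatorname{tr}(\operatorname{ad}_x)=0$ for all $x$. The $4$-dimensional Lie algebras are given in a basis $\{e_0,e_1,e_2,e_3\}$ by the following nonzero brackets (up to skew-symmetry): $\mathfrak{h}_3\times\mathbb{R}$: $[e_0,e_3]=e_2$; $\mathfrak{n}_4$: $[e_0,e_2]=e_1$, $[e_0,e_3]=e_2$; $\mathfrak{r}_{3,-1}\times\mathbb{R}$: $[e_0,e_1]=e_1$, $[e_0,e_2]=-e_2$; $\mathfrak{e}(2)\times\mathbb{R}$ (also denoted $\mathfrak{r}'_{3,0}\times\mathbb{R}$): $[e_0,e_2]=e_3$, $[e_0,e_3]=-e_2$. Given an inner product on $\mathfrak{g}$, the Levi-Civita connection is $2\langle\nabla_xy,z\rangle=\langle[x,y],z\rangle-\langle[y,z],x\rangle+\langle[z,x],y\rangle$, acting on $p$-forms by $(\nabla_x\omega)(x_1,\dots,x_p)=-\sum_i\omega(x_1,\dots,\nabla_xx_i,\dots,x_p)$. The exterior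 derivative is $d\omega(x_0,\dots,x_p)=\sum_{i<j}(-1)^{i+j}\omega([x_i,x_j],x_0,\dots,\hat{x}_i,\dots,\hat{x}_j,\dots,x_p)$ and the codifferential is $d^*\omega=-\sum_i e_i\lrcorner\nabla_{e_i}\omega$ for any orthonormal basis $\{e_i\}$. With $x^*=\langle x,\cdot\rangle$ and $n=\dim\mathfrak{g}$, a $p$-form $\omega\in\Lambda^p\mathfrak{g}^*$ is conformal Killing (CKY) if $\nabla_x\omega=\frac{1}{p+1}x\lrcorner d\omega-\frac{1}{n-p+1}x^*\wedge d^*\omega$ for all $x\in\mathfrak{g}$, and Killing (KY) if $\nabla_x\omega=\frac{1}{p+1}x\lrcorner d\omega$ for all $x\in\mathfrak{g}$. A strict CKY form is a CKY form which is not KY. *)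

theory Defs
  imports "HOL-Analysis.Analysis"
begin

section \<open>Real Lie algebras\<close>

definition lie_algebra :: "('a::real_vector \<Rightarrow> 'a \<Rightarrow> 'a) \<Rightarrow> bool" where
  "lie_algebra br \<longleftrightarrow> bilinear br \<and> (\<forall>x. br x x = 0) \<and>
     (\<forall>x y z. br x (br y z) + br y (br z x) + br z (br x y) = 0)"

definition lie_isomorphic ::
    "('a::real_vector \<Rightarrow> 'a \<Rightarrow> 'a) \<Rightarrow> ('b::real_vector \<Rightarrow> 'b \<Rightarrow> 'b) \<Rightarrow> bool" where
  "lie_isomorphic br br' \<longleftrightarrow>
     (\<exists>f. linear f \<and> bij f \<and> (\<forall>x y. f (br x y) = br' (f x) (f y)))"

definition lie_ideal :: "('a::real_vector \<Rightarrow> 'a \<Rightarrow> 'a) \<Rightarrow> 'a set \<Rightarrow> bool" where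
  "lie_ideal br I \<longleftrightarrow> subspace I \<and> (\<forall>x. \<forall>y\<in>I. br x y \<in> I)"

definition almost_abelian :: "('a::real_vector \<Rightarrow> 'a \<Rightarrow> 'a) \<Rightarrow> bool" where
  "almost_abelian br \<longleftrightarrow>
     (\<exists>I. lie_ideal br I \<and> (\<forall>x\<in>I. \<forall>y\<in>I. br x y = 0) \<and>
          dim I + 1 = dim (UNIV :: 'a set))"

definition basis_of_space :: "'a::real_vector set \<Rightarrow> bool" where
  "basis_of_space B \<longleftrightarrow> independent B \<and> span B = UNIV"

text \<open>Trace of an endomorphism of a finite-dimensional space; it does not depend on the
  basis that is chosen.\<close>

definition lin_trace :: "('a::real_vector \<Rightarrow> 'a) \<Rightarrow> real" where
  "lin_trace f = (let B = (SOME B. basis_of_space B) in \<Sum>b\<in>B. representation B (f b) b)"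

definition unimodular :: "('a::real_vector \<Rightarrow> 'a \<Rightarrow> 'a) \<Rightarrow> bool" where
  "unimodular br \<longleftrightarrow> (\<forall>x. lin_trace (br x) = 0)"

section \<open>Metric Lie algebras and forms\<close>

definition inner_product :: "('a::real_vector \<Rightarrow> 'a \<Rightarrow> real) \<Rightarrow> bool" where
  "inner_product ip \<longleftrightarrow> bilinear ip \<and> (\<forall>x y. ip x y = ip y x) \<and> (\<forall>x. x \<noteq> 0 \<longrightarrow> ip x x > 0)"

definition orthonormal_basis :: "('a::real_vector \<Rightarrow> 'a \<Rightarrow> real) \<Rightarrow> 'a set \<Rightarrow> bool" where
  "orthonormal_basis ip E \<longleftrightarrow> basis_of_space E \<and>
     (\<forall>u\<in>E. \<forall>v\<in>E. ip u v = (if u = v then 1 else 0))"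

definition levi_civita ::
    "('a::real_vector \<Rightarrow> 'a \<Rightarrow> 'a) \<Rightarrow> ('a \<Rightarrow> 'a \<Rightarrow> real) \<Rightarrow> 'a \<Rightarrow> 'a \<Rightarrow> 'a" where
  "levi_civita br ip x y =
     (THE v. \<forall>z. 2 * ip v z = ip (br x y) z - ip (br y z) x + ip (br z x) y)"

text \<open>A \<open>p\<close>-form is represented by a function on lists of vectors, of which only the values
  on lists of length \<open>p\<close> are relevant: identities between \<open>p\<close>-forms are stated for
  arguments of length \<open>p\<close>.\<close>

definition alternating_form :: "nat \<Rightarrow> ('a::real_vector list \<Rightarrow> real) \<Rightarrow> bool" where
  "alternating_form p \<omega> \<longleftrightarrow>
     (\<forall>xs i. length xs = p \<longrightarrow> i < p \<longrightarrow> linear (\<lambda>v. \<omega> (xs[i := v]))) \<and>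
     (\<forall>xs i j. length xs = p \<longrightarrow> i < j \<longrightarrow> j < p \<longrightarrow> xs ! i = xs ! j \<longrightarrow> \<omega> xs = 0)"

definition contract :: "'a \<Rightarrow> ('a list \<Rightarrow> real) \<Rightarrow> 'a list \<Rightarrow> real" where
  "contract x \<omega> xs = \<omega> (x # xs)"

text \<open>The wedge product of a one-form with a form, normalised so that
  \<open>(\<alpha> \<and> \<beta>)(x, y) = \<alpha>(x) \<beta>(y) - \<alpha>(y) \<beta>(x)\<close> for one-forms.\<close>

definition wedge1 :: "('a \<Rightarrow> real) \<Rightarrow> ('a list \<Rightarrow> real) \<Rightarrow> 'a list \<Rightarrow> real" where
  "wedge1 \<alpha> \<eta> xs = (\<Sum>i<length xs. (- 1) ^ i * \<alpha> (xs ! i) * \<eta> (nths xs (- {i})))"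

definition ext_d :: "('a \<Rightarrow> 'a \<Rightarrow> 'a) \<Rightarrow> ('a list \<Rightarrow> real) \<Rightarrow> 'a list \<Rightarrow> real" where
  "ext_d br \<omega> xs = (\<Sum>j<length xs. \<Sum>i<j.
     (- 1) ^ (i + j) * \<omega> (br (xs ! i) (xs ! j) # nths xs (- {i, j})))"

definition nabla ::
    "('a::real_vector \<Rightarrow> 'a \<Rightarrow> 'a) \<Rightarrow> ('a \<Rightarrow> 'a \<Rightarrow> real) \<Rightarrow> 'a \<Rightarrow> ('a list \<Rightarrow> real) \<Rightarrow> 'a list \<Rightarrow> real"
where
  "nabla br ip x \<omega> xs = - (\<Sum>i<length xs. \<omega> (xs[i := levi_civita br ip x (xs ! i)]))"

text \<open>The codifferential does not depend on the orthonormal basis that is chosen.\<close>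

definition codiff ::
    "('a::real_vector \<Rightarrow> 'a \<Rightarrow> 'a) \<Rightarrow> ('a \<Rightarrow> 'a \<Rightarrow> real) \<Rightarrow> ('a list \<Rightarrow> real) \<Rightarrow> 'a list \<Rightarrow> real"
where
  "codiff br ip \<omega> xs = (let E = (SOME E. orthonormal_basis ip E) in
     - (\<Sum>e\<in>E. contract e (nabla br ip e \<omega>) xs))"

definition conformal_killing_form ::
    "('a::real_vector \<Rightarrow> 'a \<Rightarrow> 'a) \<Rightarrow> ('a \<Rightarrow> 'a \<Rightarrow> real) \<Rightarrow> nat \<Rightarrow> ('a list \<Rightarrow> real) \<Rightarrow> bool" where
  "conformal_killing_form br ip p \<omega> \<longleftrightarrow> alternating_form p \<omega> \<and>
     (\<forall>x xs. length xs = p \<longrightarrow>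
        nabla br ip x \<omega> xs =
          1 / (real p + 1) * contract x (ext_d br \<omega>) xs
          - 1 / (real (dim (UNIV :: 'a set)) - real p + 1) * wedge1 (ip x) (codiff br ip \<omega>) xs)"

definition killing_form ::
    "('a::real_vector \<Rightarrow> 'a \<Rightarrow> 'a) \<Rightarrow> ('a \<Rightarrow> 'a \<Rightarrow> real) \<Rightarrow> nat \<Rightarrow> ('a list \<Rightarrow> real) \<Rightarrow> bool" where
  "killing_form br ip p \<omega> \<longleftrightarrow> alternating_form p \<omega> \<and>
     (\<forall>x xs. length xs = p \<longrightarrow>
        nabla br ip x \<omega> xs = 1 / (real p + 1) * contract x (ext_d br \<omega>) xs)"

definition strict_CKY_form ::
    "('a::real_vector \<Rightarrow> 'a \<Rightarrow> 'a) \<Rightarrow> ('a \<Rightarrow> 'a \<Rightarrow> real) \<Rightarrow> nat \<Rightarrow> ('a list \<Rightarrow> real) \<Rightarrow> bool" where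
  "strict_CKY_form br ip p \<omega> \<longleftrightarrow>
     conformal_killing_form br ip p \<omega> \<and> \<not> killing_form br ip p \<omega>"

section \<open>The four-dimensional model algebras\<close>

text \<open>The models live on \<open>real^4\<close>, whose index type has the elements \<open>0, 1, 2, 3\<close>;
  \<open>be i\<close> is the basis vector \<open>e\<^sub>i\<close>. Expanding
  \<open>[x, y]\<close> bilinearly, a bracket \<open>[e\<^sub>i, e\<^sub>j] = v\<close> contributes \<open>minor i j x y *\<^sub>R v\<close>.\<close>

definition be :: "4 \<Rightarrow> real^4" where
  "be i = axis i 1"

definition minor :: "4 \<Rightarrow> 4 \<Rightarrow> real^4 \<Rightarrow> real^4 \<Rightarrow> real" where
  "minor i j x y = x $ i * y $ j - x $ j * y $ i"

definition h3_R :: "real^4 \<Rightarrow> real^4 \<Rightarrow> real^4" where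
  "h3_R x y = minor 0 3 x y *\<^sub>R be 2"

definition n4 :: "real^4 \<Rightarrow> real^4 \<Rightarrow> real^4" where
  "n4 x y = minor 0 2 x y *\<^sub>R be 1 + minor 0 3 x y *\<^sub>R be 2"

definition r3m1_R :: "real^4 \<Rightarrow> real^4 \<Rightarrow> real^4" where
  "r3m1_R x y = minor 0 1 x y *\<^sub>R be 1 - minor 0 2 x y *\<^sub>R be 2"

definition euclid2_R :: "real^4 \<Rightarrow> real^4 \<Rightarrow> real^4" where
  "euclid2_R x y = minor 0 2 x y *\<^sub>R be 3 - minor 0 3 x y *\<^sub>R be 2"

lemma model_brackets:
  "h3_R (be 0) (be 3) = be 2"
  "h3_R (be 0) (be 1) = 0" "h3_R (be 0) (be 2) = 0" "h3_R (be 1) (be 2) = 0"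
  "h3_R (be 1) (be 3) = 0" "h3_R (be 2) (be 3) = 0"
  "n4 (be 0) (be 2) = be 1" "n4 (be 0) (be 3) = be 2"
  "n4 (be 0) (be 1) = 0" "n4 (be 1) (be 2) = 0" "n4 (be 1) (be 3) = 0" "n4 (be 2) (be 3) = 0"
  "r3m1_R (be 0) (be 1) = be 1" "r3m1_R (be 0) (be 2) = - be 2"
  "r3m1_R (be 0) (be 3) = 0" "r3m1_R (be 1) (be 2) = 0" "r3m1_R (be 1) (be 3) = 0"
  "r3m1_R (be 2) (be 3) = 0"
  "euclid2_R (be 0) (be 2) = be 3" "euclid2_R (be 0) (be 3) = - be 2"
  "euclid2_R (be 0) (be 1) = 0" "euclid2_R (be 1) (be 2) = 0" "euclid2_R (be 1) (be 3) = 0"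
  "euclid2_R (be 2) (be 3) = 0"
  by (simp_all add: h3_R_def n4_def r3m1_R_def euclid2_R_def minor_def be_def axis_def)

lemma lie_algebra_models:
  "lie_algebra h3_R" "lie_algebra n4" "lie_algebra r3m1_R" "lie_algebra euclid2_R"
  unfolding lie_algebra_def bilinear_def
  by (auto intro!: linearI
      simp: h3_R_def n4_def r3m1_R_def euclid2_R_def minor_def be_def vec_eq_iff axis_def algebra_simps)

end

theory Submission
  imports Defs
begin

text \<open>In dimension four every 3-form is \<open>\<omega> = vol(\<xi>, -, -, -)\<close> for a unique vector \<open>\<xi>\<close>, and the covariant derivative commutes
  with this Hodge isomorphism. The exterior derivative \<open>d \<omega>\<close> is \<open>- tr (ad \<xi>)\<close> times the volume form, which is zero on
  a unimodular algebra. The conformal Killing equation for \<open>\<omega>\<close> then says that \<open>\<nabla> \<xi>\<close> is skew-symmetric, that is, that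
  \<open>ad \<xi>\<close> is skew-symmetric, and \<open>\<omega>\<close> is Killing exactly when \<open>\<nabla> \<xi> = 0\<close>. Since
  \<open>2 \<langle>\<nabla>\<^sub>x \<xi>, y\<rangle> = \<langle>\<xi>, [y, x]\<rangle>\<close> for such \<open>\<xi>\<close>, strict conformal Killing 3-forms correspond to vectors \<open>\<xi>\<close> with
  \<open>ad \<xi>\<close> skew that are not orthogonal to the derived algebra (\<open>strict_CKY_gives_skew\<close>, \<open>skew_gives_strict_CKY\<close>).

  On an almost abelian algebra such a \<open>\<xi>\<close> lies in the abelian ideal and is central (\<open>skew_gives_central\<close>). Conversely, if
  there are a central \<open>u \<noteq> 0\<close> and a bracket \<open>v \<noteq> 0\<close>, some inner product has \<open>\<langle>u, v\<rangle> \<noteq> 0\<close>, and \<open>\<xi> = u\<close> works.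
  So the metric question becomes a purely algebraic one: which nonabelian algebras in the class have a nonzero central
  element in the ideal? They are given by a nonzero, singular, traceless endomorphism of a three-dimensional space, up
  to conjugation and scaling. Its eigenvalues are \<open>0, \<lambda>, - \<lambda>\<close> with \<open>\<lambda>\<^sup>2\<close> real, and the cases \<open>\<lambda>\<^sup>2 > 0\<close>,
  \<open>\<lambda>\<^sup>2 < 0\<close> and \<open>\<lambda> = 0\<close> with rank two or one give the four models (\<open>almost_abelian_classification\<close>).\<close>

section \<open>Bases, frames and the trace\<close>

lemma basis_sets_finite_card:
  fixes B C :: "'a::real_vector set"
  assumes "basis_of_space B" "basis_of_space C" "finite B"
  shows "finite C \<and> card C = card B"
  using assms real_vector.independent_span_bound[of B C] real_vector.independent_span_bound[of C B]
  unfolding basis_of_space_def by (metis order_antisym subset_UNIV)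

lemma subspace_basis_extending:
  fixes U S :: "'a::real_vector set"
  assumes "dim (UNIV :: 'a set) = 4" and S: "independent S" "S \<subseteq> U" and U: "subspace U"
  shows "\<exists>C. S \<subseteq> C \<and> finite C \<and> independent C \<and> span C = U \<and> card C = dim U"
proof -
  obtain B :: "'a set" where B: "independent B" "span B = UNIV"
    using real_vector.maximal_independent_subset[of UNIV] by (metis UNIV_I UNIV_eq_I subsetD)
  have "card B = dim (UNIV :: 'a set)"
    using B by (metis real_vector.dim_eq_card span_UNIV)
  \<comment> \<open>The cardinality of an infinite set is \<open>0\<close>, so dimension \<open>4\<close> forces a finite basis.\<close>
  then have fB: "finite B" using assms(1) by (simp add: card_ge_0_finite)
  obtain C where C: "S \<subseteq> C" "C \<subseteq> U" "independent C" "U \<subseteq> span C"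
    using real_vector.maximal_independent_subset_extend[of S U] S by auto
  have sp: "span C = U"
    using C U real_vector.span_minimal by blast
  then have "card C = dim U"
    using C by (metis real_vector.dim_eq_card real_vector.dim_span)
  moreover have "finite C"
    using real_vector.independent_span_bound[of B C] B fB C by auto
  ultimately show ?thesis using C sp by blast
qed

lemma independent_four_spans:
  fixes S :: "'a::real_vector set"
  assumes d: "dim (UNIV :: 'a set) = 4" and S: "independent S" "card S = 4"
  shows "span S = UNIV"
proof -
  obtain C where "S \<subseteq> C" "finite C" "span C = UNIV" "card C = 4"
    using subspace_basis_extending[OF d S(1), of UNIV] d by auto
  then show ?thesis using S(2) by (metis card_subset_eq)
qed

text \<open>Writing \<open>f b\<close> in the basis \<open>C\<close> and then each \<open>c \<in> C\<close> in the basis \<open>B\<close> turns both traces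
  into the same double sum over \<open>B \<times> C\<close>.\<close>

lemma trace_basis_independent:
  fixes f :: "'a::real_vector \<Rightarrow> 'a"
  assumes f: "linear f" and B: "basis_of_space B" "finite B" and C: "basis_of_space C" "finite C"
  shows "(\<Sum>b\<in>B. representation B (f b) b) = (\<Sum>c\<in>C. representation C (f c) c)"
proof -
  have iB: "independent B" "x \<in> span B" and iC: "independent C" "x \<in> span C" for x
    using B C by (auto simp: basis_of_space_def)
  have exp: "(\<Sum>c\<in>C. representation C x c *\<^sub>R c) = x" for x
    using real_vector.sum_representation_eq[of C x C] iC C by auto
  have expB: "(\<Sum>c\<in>B. representation B x c *\<^sub>R c) = x" for x
    using real_vector.sum_representation_eq[of B x B] iB B by auto
  have "representation B (f b) b = (\<Sum>c\<in>C. representation C (f b) c * representation B c b)" for b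
  proof -
    have "representation B (f b) b = representation B (\<Sum>c\<in>C. representation C (f b) c *\<^sub>R c) b"
      by (simp only: exp)
    then show ?thesis
      using iB by (simp add: real_vector.representation_sum real_vector.representation_scale)
  qed
  moreover have "representation C (f c) c = (\<Sum>b\<in>B. representation C (f b) c * representation B c b)" for c
  proof -
    have "representation C (f c) c = representation C (f (\<Sum>b\<in>B. representation B c b *\<^sub>R b)) c"
      by (simp only: expB)
    then show ?thesis
      using iC by (simp add: linear_sum[OF f] linear_scale[OF f] mult.commute
        real_vector.representation_sum real_vector.representation_scale)
  qed
  ultimately show ?thesis
    by (simp add: sum.swap[of _ B C])
qed

definition frame :: "('i::finite \<Rightarrow> 'a::real_vector) \<Rightarrow> bool" where
  "frame b \<longleftrightarrow> inj b \<and> basis_of_space (range b)"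

lemma frame_expansion:
  assumes "frame b"
  shows "(\<Sum>i\<in>UNIV. representation (range b) x (b i) *\<^sub>R b i) = x"
proof -
  have "(\<Sum>i\<in>UNIV. representation (range b) x (b i) *\<^sub>R b i)
      = (\<Sum>v\<in>range b. representation (range b) x v *\<^sub>R v)"
    using assms by (simp add: frame_def sum.reindex)
  also have "\<dots> = x"
    using real_vector.sum_representation_eq[of "range b" x "range b"] assms
    by (auto simp: frame_def basis_of_space_def)
  finally show ?thesis .
qed

lemma frame_coordinates:
  assumes "frame b"
  shows "representation (range b) (\<Sum>i\<in>UNIV. a i *\<^sub>R b i) (b j) = a j"
proof -
  have "representation (range b) (\<Sum>i\<in>UNIV. a i *\<^sub>R b i) (b j)
     = (\<Sum>i\<in>UNIV. a i * (if b j = b i then 1 else 0))"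
    using assms by (simp add: frame_def basis_of_space_def real_vector.representation_sum
        real_vector.representation_scale real_vector.representation_basis)
  also have "\<dots> = (\<Sum>i\<in>UNIV. if i = j then a i else 0)"
    using assms by (intro sum.cong) (auto simp: frame_def dest: injD)
  finally show ?thesis by simp
qed

lemma lin_trace_frame:
  assumes "linear f" "frame b" and M: "\<And>j. f (b j) = (\<Sum>i\<in>UNIV. M i j *\<^sub>R b i)"
  shows "lin_trace f = (\<Sum>i\<in>UNIV. M i i)"
proof -
  have b: "basis_of_space (range b)" "inj b" using assms by (auto simp: frame_def)
  have S: "basis_of_space (SOME B :: 'a set. basis_of_space B)"
    using b(1) by (rule someI)
  have "lin_trace f = (\<Sum>v\<in>range b. representation (range b) (f v) v)"
    unfolding lin_trace_def Let_def
    using basis_sets_finite_card[OF b(1) S]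
    by (intro trace_basis_independent assms S b) auto
  also have "\<dots> = (\<Sum>i\<in>UNIV. representation (range b) (f (b i)) (b i))"
    using b(2) by (simp add: sum.reindex)
  also have "\<dots> = (\<Sum>i\<in>UNIV. M i i)"
    by (simp add: M frame_coordinates[OF assms(2)])
  finally show ?thesis .
qed

lemma frame_of_basis:
  fixes B :: "'a::real_vector set"
  assumes "basis_of_space B" "card B = CARD('i::finite)"
  shows "\<exists>b :: 'i \<Rightarrow> 'a. frame b \<and> range b = B"
proof -
  have "finite B" using assms(2) by (simp add: card_ge_0_finite)
  then obtain b :: "'i \<Rightarrow> 'a" where "bij_betw b UNIV B"
    using assms(2) finite_same_card_bij[of "UNIV :: 'i set" B] by auto
  then show ?thesis using assms by (auto simp: frame_def bij_betw_def)
qed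

text \<open>A vector outside a hyperplane completes any basis of the hyperplane to a basis of the whole space.\<close>

lemma codim_one_decomposition:
  fixes U :: "'a::real_vector set"
  assumes d: "dim (UNIV :: 'a set) = 4" and U: "subspace U" "dim U + 1 = dim (UNIV :: 'a set)"
    and w: "w \<notin> U"
  shows "\<exists>t. x - t *\<^sub>R w \<in> U"
proof -
  obtain C where C: "finite C" "independent C" "span C = U" "card C = dim U"
    using subspace_basis_extending[OF d real_vector.independent_empty _ U(1)] by auto
  have "independent (insert w C)" "card (insert w C) = 4"
    using C w U(2) d real_vector.span_base[of w C]
    by (auto simp: real_vector.independent_insert card_insert_if)
  then have "x \<in> span (insert w C)"
    using independent_four_spans[OF d] by auto
  then show ?thesis using real_vector.span_breakdown_eq[of x w C] C(3) by auto
qed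

lemma four_zero: "(4::4) = 0" by simp
lemma UNIV_index4: "(UNIV :: 4 set) = {0, 1, 2, 3}"
  unfolding UNIV_4 four_zero by blast
lemma all_index4: "(\<forall>i::4. P i) \<longleftrightarrow> P 0 \<and> P 1 \<and> P 2 \<and> P 3"
  using UNIV_index4 unfolding forall_4 four_zero by blast
lemma sum_index4: "(\<Sum>i\<in>UNIV. f i) = f 0 + f 1 + f 2 + f (3::4)"
  unfolding sum_4 four_zero by (simp only: ac_simps)

text \<open>A frame of a four-dimensional space is a family indexed by the type \<open>4\<close>, so that it can be matched
  with the basis \<open>be\<close> of the models; \<open>quad\<close> builds such a family from four named entries.\<close>

definition quad :: "'a \<Rightarrow> 'a \<Rightarrow> 'a \<Rightarrow> 'a \<Rightarrow> 4 \<Rightarrow> 'a" where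
  "quad a x y z i = (if i = 0 then a else if i = 1 then x else if i = 2 then y else z)"

lemma quad_simps [simp]:
  "quad a x y z 0 = a" "quad a x y z 1 = x" "quad a x y z 2 = y" "quad a x y z 3 = z"
  by (simp_all add: quad_def)

lemma frameI_independent:
  fixes b :: "4 \<Rightarrow> 'a::real_vector"
  assumes d: "dim (UNIV :: 'a set) = 4"
    and ind: "\<And>c. (\<Sum>i\<in>UNIV. c i *\<^sub>R b i) = 0 \<Longrightarrow> (\<forall>i. c i = 0)"
  shows "frame b"
proof -
  have inj: "inj b"
  proof (rule injI, rule ccontr)
    fix i j assume "b i = b j" "i \<noteq> j"
    then have "(\<Sum>k\<in>UNIV. (of_bool (k = i) - of_bool (k = j)) *\<^sub>R b k) = 0"
      by (simp add: algebra_simps sum_subtractf of_bool_def if_distrib[of "\<lambda>r. r *\<^sub>R _"] cong: if_cong)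
    from ind[OF this] \<open>i \<noteq> j\<close> show False by (auto dest: spec[of _ i])
  qed
  have "independent (range b)"
  proof (rule real_vector.independent_if_scalars_zero)
    fix f v assume "(\<Sum>x\<in>range b. f x *\<^sub>R x) = 0" "v \<in> range b"
    then show "f v = 0"
      using ind[of "\<lambda>i. f (b i)"] inj by (auto simp: sum.reindex)
  qed simp
  moreover have "card (range b) = 4" using inj by (simp add: card_image)
  ultimately show ?thesis
    using independent_four_spans[OF d] inj by (auto simp: frame_def basis_of_space_def)
qed

section \<open>Lie algebras given by structure constants\<close>

lemma lie_algebra_bilinear: "lie_algebra br \<Longrightarrow> bilinear br"
  by (simp add: lie_algebra_def)

lemma lie_algebra_anticommute:
  assumes "lie_algebra br" shows "br y x = - br x y"
proof -
  have b: "bilinear br" and z: "\<And>x. br x x = 0" using assms by (auto simp: lie_algebra_def)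
  have "br x y + br y x = br (x + y) (x + y)"
    using z[of x] z[of y] by (simp add: bilinear_ladd[OF b] bilinear_radd[OF b])
  then have "br x y + br y x = 0" by (simp only: z)
  then show ?thesis by (simp add: eq_neg_iff_add_eq_0 add.commute)
qed

text \<open>The coordinate map of a frame is an isomorphism of Lie algebras as soon as the structure constants
  agree, because both sides of the homomorphism equation are bilinear.\<close>

lemma lie_isomorphic_from_frame:
  fixes br :: "'a::real_vector \<Rightarrow> 'a \<Rightarrow> 'a" and m :: "real^4 \<Rightarrow> real^4 \<Rightarrow> real^4"
  assumes br: "lie_algebra br" and m: "lie_algebra m" and fr: "frame b"
    and eq: "\<And>i j. br (b i) (b j) = (\<Sum>k\<in>UNIV. m (be i) (be j) $ k *\<^sub>R b k)"
  shows "lie_isomorphic br m"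
proof -
  define f where "f x = (\<chi> i. representation (range b) x (b i))" for x
  define g where "g v = (\<Sum>i\<in>UNIV. v $ i *\<^sub>R b i)" for v :: "real^4"
  have gl: "linear g"
    by (rule linearI) (simp_all add: g_def scaleR_left_distrib sum.distrib scaleR_sum_right)
  have gf: "g (f x) = x" for x by (simp add: g_def f_def frame_expansion[OF fr])
  have fg: "f (g v) = v" for v by (simp add: g_def f_def frame_coordinates[OF fr])
  have fl: "linear f"
  proof (rule linearI)
    show "f (x + y) = f x + f y" for x y
      using fg[of "f x + f y"] by (simp add: linear_add[OF gl] gf)
    show "f (c *\<^sub>R x) = c *\<^sub>R f x" for c x
      using fg[of "c *\<^sub>R f x"] by (simp add: linear_scale[OF gl] gf)
  qed
  have "bij f" using gf fg by (intro o_bij[of g]) auto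
  have fb: "f (b i) = be i" for i
  proof -
    have "g (be i) = b i"
      by (simp add: g_def be_def axis_def if_distrib[of "\<lambda>r. r *\<^sub>R _"] cong: if_cong)
    then show ?thesis using fg[of "be i"] by simp
  qed
  have "bilinear (\<lambda>x y. f (br x y))" "bilinear (\<lambda>x y. m (f x) (f y))"
    using linear_compose[OF _ fl] linear_compose[OF fl] br m
    unfolding lie_algebra_def bilinear_def o_def by blast+
  moreover have "f (br (b i) (b j)) = m (f (b i)) (f (b j))" for i j
    using fg[of "m (be i) (be j)"] by (simp add: eq fb g_def)
  ultimately have "f (br x y) = m (f x) (f y)" for x y
    using bilinear_eq[of "\<lambda>x y. f (br x y)" "\<lambda>x y. m (f x) (f y)" UNIV "range b" UNIV "range b" x y]
      fr by (auto simp: frame_def basis_of_space_def)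
  then show ?thesis unfolding lie_isomorphic_def using fl \<open>bij f\<close> by blast
qed

lemma lie_isomorphic_from_quad:
  fixes br :: "'a::real_vector \<Rightarrow> 'a \<Rightarrow> 'a" and m :: "real^4 \<Rightarrow> real^4 \<Rightarrow> real^4"
  assumes br: "lie_algebra br" and m: "lie_algebra m" and fr: "frame (quad w x y z)"
    and ab: "br x y = 0" "br x z = 0" "br y z = 0"
      "m (be 1) (be 2) = 0" "m (be 1) (be 3) = 0" "m (be 2) (be 3) = 0"
    and eq: "br w x = (\<Sum>k\<in>UNIV. m (be 0) (be 1) $ k *\<^sub>R quad w x y z k)"
      "br w y = (\<Sum>k\<in>UNIV. m (be 0) (be 2) $ k *\<^sub>R quad w x y z k)"
      "br w z = (\<Sum>k\<in>UNIV. m (be 0) (be 3) $ k *\<^sub>R quad w x y z k)"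
  shows "lie_isomorphic br m"
proof (rule lie_isomorphic_from_frame[OF br m fr])
  have z: "br x x = 0" "m y y = 0" for x y using br m by (auto simp: lie_algebra_def)
  note ac = lie_algebra_anticommute[OF br] lie_algebra_anticommute[OF m]
  let ?C = "\<lambda>i j. br (quad w x y z i) (quad w x y z j)
      = (\<Sum>k\<in>UNIV. m (be i) (be j) $ k *\<^sub>R quad w x y z k)"
  have swap: "?C j i" if "?C i j" for i j
    using that ac(1)[of "quad w x y z i" "quad w x y z j"] ac(2)[of "be i" "be j"]
    by (simp add: sum_negf)
  have diag: "?C i i" for i by (simp add: z)
  have "?C 0 1" "?C 0 2" "?C 0 3" "?C 1 2" "?C 1 3" "?C 2 3"
    using ab eq by simp_all
  then have "\<forall>i j. ?C i j"
    unfolding all_index4 using diag swap by blast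
  then show "?C i j" for i j by blast
qed

section \<open>The volume form\<close>

text \<open>The Laplace expansion of the \<open>4 \<times> 4\<close> determinant along its first two rows; as a polynomial in the
  coordinates it is open to direct algebraic verification.\<close>

definition vol4 :: "real^4 \<Rightarrow> real^4 \<Rightarrow> real^4 \<Rightarrow> real^4 \<Rightarrow> real" where
  "vol4 a b c d =
     minor 0 1 a b * minor 2 3 c d - minor 0 2 a b * minor 1 3 c d
     + minor 0 3 a b * minor 1 2 c d + minor 1 2 a b * minor 0 3 c d
     - minor 1 3 a b * minor 0 2 c d + minor 2 3 a b * minor 0 1 c d"

lemma vol4_swap:
  "vol4 b a c d = - vol4 a b c d" "vol4 a c b d = - vol4 a b c d" "vol4 a b d c = - vol4 a b c d"
  unfolding vol4_def minor_def by algebra+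

text \<open>The infinitesimal form of \<open>det (M A) = det M * det A\<close>. This identity drives everything that follows: applied to
  \<open>\<nabla>\<^sub>x\<close> it differentiates 3-forms, applied to \<open>y \<mapsto> \<nabla>\<^sub>y \<xi>\<close> it computes their exterior derivative, and
  applied to maps of rank one it yields the conformal Killing equation.\<close>

lemma vol4_derivation:
  fixes M :: "real^4^4"
  shows "vol4 (M *v a) b c d + vol4 a (M *v b) c d + vol4 a b (M *v c) d + vol4 a b c (M *v d)
    = trace M * vol4 a b c d"
  unfolding vol4_def minor_def trace_def matrix_vector_mult_def
  by (simp add: sum_index4) algebra

lemma vol4_add: "vol4 (a + a') b c d = vol4 a b c d + vol4 a' b c d"
  by (simp add: vol4_def minor_def algebra_simps)

lemma vol4_scale: "vol4 (r *\<^sub>R a) b c d = r * vol4 a b c d"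
  by (simp add: vol4_def minor_def algebra_simps)

locale orthonormal_frame =
  fixes ip :: "'a::real_vector \<Rightarrow> 'a \<Rightarrow> real" and e :: "4 \<Rightarrow> 'a"
  assumes inner: "inner_product ip"
    and orthonormal: "ip (e i) (e j) = (if i = j then 1 else 0)"
    and frame: "frame e"
begin

lemma ip_bilinear: "bilinear ip"
  and ip_commute: "ip x y = ip y x"
  and ip_pos: "x \<noteq> 0 \<Longrightarrow> ip x x > 0"
  using inner unfolding inner_product_def by blast+

lemmas ip_simps [simp] =
  bilinear_ladd[OF ip_bilinear] bilinear_radd[OF ip_bilinear]
  bilinear_lsub[OF ip_bilinear] bilinear_rsub[OF ip_bilinear]
  bilinear_lneg[OF ip_bilinear] bilinear_rneg[OF ip_bilinear]
  bilinear_lmul[OF ip_bilinear] bilinear_rmul[OF ip_bilinear]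
  bilinear_lzero[OF ip_bilinear] bilinear_rzero[OF ip_bilinear]

lemma ip_linear_left: "linear (\<lambda>x. ip x y)" and ip_linear_right: "linear (\<lambda>y. ip x y)"
  using ip_bilinear by (simp_all add: bilinear_def)

lemma ip_sum_frame: "ip (\<Sum>i\<in>UNIV. c i *\<^sub>R e i) (e j) = c j"
proof -
  have "ip (\<Sum>i\<in>UNIV. c i *\<^sub>R e i) (e j) = (\<Sum>i\<in>UNIV. c i * ip (e i) (e j))"
    by (simp add: linear_sum[OF ip_linear_left])
  then show ?thesis by (simp add: orthonormal if_distrib cong: if_cong)
qed

lemma expansion: "(\<Sum>i\<in>UNIV. ip x (e i) *\<^sub>R e i) = x"
  using frame_expansion[OF frame, of x] ip_sum_frame[of "\<lambda>i. representation (range e) x (e i)"]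
  by simp

lemma vector_eqI: "(\<And>z. ip v z = ip w z) \<Longrightarrow> v = w"
  using ip_pos[of "v - w"] by force

lemma parseval: "ip x y = (\<Sum>i\<in>UNIV. ip x (e i) * ip y (e i))"
proof -
  have "ip x y = ip x (\<Sum>i\<in>UNIV. ip y (e i) *\<^sub>R e i)" by (simp only: expansion)
  then show ?thesis by (simp add: linear_sum[OF ip_linear_right] mult.commute)
qed

definition coord :: "'a \<Rightarrow> real^4" where "coord x = (\<chi> i. ip x (e i))"

lemma coord_linear: "linear coord"
  by (rule linearI) (simp_all add: coord_def vec_eq_iff)

lemma coord_matrix:
  assumes "linear N"
  shows "coord (N x) = (\<chi> i j. ip (N (e j)) (e i)) *v coord x"
proof -
  have "ip (N x) (e i) = (\<Sum>j\<in>UNIV. ip (N (e j)) (e i) * ip x (e j))" for i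
  proof -
    have "ip (N x) (e i) = ip (N (\<Sum>j\<in>UNIV. ip x (e j) *\<^sub>R e j)) (e i)" by (simp only: expansion)
    then show ?thesis
      by (simp add: linear_sum[OF assms] linear_scale[OF assms] linear_sum[OF ip_linear_left] mult.commute)
  qed
  then show ?thesis by (simp add: coord_def vec_eq_iff matrix_vector_mult_def)
qed

definition tr :: "('a \<Rightarrow> 'a) \<Rightarrow> real" where "tr N = (\<Sum>i\<in>UNIV. ip (N (e i)) (e i))"

lemma tr_eq_lin_trace: "linear N \<Longrightarrow> tr N = lin_trace N"
  unfolding tr_def
  using lin_trace_frame[OF _ frame, of N "\<lambda>i j. ip (N (e j)) (e i)"] by (simp add: expansion)

lemma tr_skew: "(\<And>x. ip (N x) x = 0) \<Longrightarrow> tr N = 0"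
  by (simp add: tr_def)

definition vol :: "'a \<Rightarrow> 'a \<Rightarrow> 'a \<Rightarrow> 'a \<Rightarrow> real" where
  "vol a b c d = vol4 (coord a) (coord b) (coord c) (coord d)"

lemma vol_swap:
  "vol b a c d = - vol a b c d" "vol a c b d = - vol a b c d" "vol a b d c = - vol a b c d"
  unfolding vol_def by (rule vol4_swap)+

lemma vol_linear:
  "linear (\<lambda>x. vol x b c d)" "linear (\<lambda>x. vol a x c d)"
  "linear (\<lambda>x. vol a b x d)" "linear (\<lambda>x. vol a b c x)"
proof -
  have lin: "linear (\<lambda>x. vol x b c d)" for b c d
    by (rule linearI)
      (simp_all add: vol_def linear_add[OF coord_linear] linear_scale[OF coord_linear] vol4_add vol4_scale)
  have neg: "linear (\<lambda>x. - f x)" if "linear f" for f :: "'a \<Rightarrow> real"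
    using that by (simp add: linear_compose_neg)
  show "linear (\<lambda>x. vol x b c d)" by (rule lin)
  show 2: "linear (\<lambda>x. vol a x c d)" for a b c d
    using neg[OF lin] by (subst vol_swap(1))
  show 3: "linear (\<lambda>x. vol a b x d)" for a b c d
    using neg[OF 2] by (subst vol_swap(2))
  show "linear (\<lambda>x. vol a b c x)"
    using neg[OF 3] by (subst vol_swap(3))
qed

lemma vol_derivation:
  assumes "linear N"
  shows "vol (N a) b c d + vol a (N b) c d + vol a b (N c) d + vol a b c (N d) = tr N * vol a b c d"
  unfolding vol_def coord_matrix[OF assms] vol4_derivation
  by (simp add: trace_def tr_def)

lemma coord_frame: "coord (e i) = be i"
  by (auto simp: coord_def be_def axis_def vec_eq_iff orthonormal)

text \<open>A 3-form \<open>vol v\<close> records the coordinates of \<open>v\<close>, with alternating signs, as its values on triples of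
  frame vectors.\<close>

lemma vol_frame:
  "vol v (e 1) (e 2) (e 3) = ip v (e 0)" "vol v (e 0) (e 2) (e 3) = - ip v (e 1)"
  "vol v (e 0) (e 1) (e 3) = ip v (e 2)" "vol v (e 0) (e 1) (e 2) = - ip v (e 3)"
  unfolding vol_def coord_frame
  by (simp_all add: vol4_def minor_def be_def axis_def coord_def)

lemma vol_nondegenerate:
  assumes "\<And>a b c. vol v a b c = 0" shows "v = 0"
proof -
  have "\<forall>i. ip v (e i) = 0"
    unfolding all_index4 using assms vol_frame[of v] by simp
  then show ?thesis using expansion[of v] by simp
qed

text \<open>The derivation identity for the map \<open>y \<mapsto> ip x y *\<^sub>R v\<close>, whose trace is \<open>ip x v\<close>. It is Cramer's rule for
  five vectors in dimension four.\<close>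

lemma vol_cramer:
  "ip x a * vol v b c d + ip x b * vol a v c d + ip x c * vol a b v d + ip x d * vol a b c v
    = ip x v * vol a b c d"
proof -
  have l: "linear (\<lambda>y. ip x y *\<^sub>R v)"
    by (rule linearI) (simp_all add: scaleR_left_distrib)
  have "tr (\<lambda>y. ip x y *\<^sub>R v) = ip x v"
    by (simp add: tr_def parseval[of x v])
  then show ?thesis
    using vol_derivation[OF l, of a b c d] by (simp add: linear_scale[OF vol_linear(1)]
      linear_scale[OF vol_linear(2)] linear_scale[OF vol_linear(3)] linear_scale[OF vol_linear(4)])
qed

text \<open>The algebraic core of the conformal Killing equation: if \<open>N = \<nabla> \<xi>\<close> is skew-symmetric, then the 3-form dual to
  \<open>N x\<close> has the shape \<open>x\<^sup>* \<and> \<eta>\<close>, with a 2-form \<open>\<eta>\<close> that does not depend on \<open>x\<close>. It arises by summing \<open>vol_cramer\<close>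
  with \<open>v = N (e i)\<close> over the frame: the first summand adds up to \<open>vol (N x)\<close>, and
  by skewness the right-hand side adds up to \<open>- vol (N x)\<close>, whence the factor \<open>2\<close>.\<close>

lemma vol_skew:
  assumes N: "linear N" and skew: "\<And>x. ip (N x) x = 0"
  defines "\<eta> \<equiv> \<lambda>b c. - (\<Sum>i\<in>UNIV. vol (N (e i)) (e i) b c)"
  shows "vol (N x) a b c = - (ip x a * \<eta> b c - ip x b * \<eta> a c + ip x c * \<eta> a b) / 2"
proof -
  have sk: "ip x (N y) = - ip (N x) y" for x y
  proof -
    have "ip (N x) y + ip (N y) x = 0"
      using skew[of "x + y"] skew[of x] skew[of y] by (simp add: linear_add[OF N])
    then show ?thesis by (simp add: ip_commute)
  qed
  have ex: "(\<Sum>i\<in>UNIV. ip y (e i) * vol (e i) a b c) = vol y a b c" for y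
  proof -
    have "vol y a b c = vol (\<Sum>i\<in>UNIV. ip y (e i) *\<^sub>R e i) a b c" by (simp only: expansion)
    then show ?thesis
      by (simp add: linear_sum[OF vol_linear(1)] linear_scale[OF vol_linear(1)])
  qed
  have eN: "(\<Sum>i\<in>UNIV. ip x (e i) * vol (N (e i)) a b c) = vol (N x) a b c"
  proof -
    have "vol (N x) a b c = vol (N (\<Sum>i\<in>UNIV. ip x (e i) *\<^sub>R e i)) a b c" by (simp only: expansion)
    then show ?thesis
      by (simp add: linear_sum[OF N] linear_scale[OF N] linear_sum[OF vol_linear(1)]
          linear_scale[OF vol_linear(1)])
  qed
  have "ip x (e i) * vol (N (e i)) a b c - ip x a * vol (N (e i)) (e i) b c
      + ip x b * vol (N (e i)) (e i) a c - ip x c * vol (N (e i)) (e i) a b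
      = - (ip (N x) (e i) * vol (e i) a b c)" for i
  proof -
    let ?v = "N (e i)"
    have "vol (e i) ?v b c = - vol ?v (e i) b c" by (rule vol_swap)
    moreover have "vol (e i) a ?v c = vol ?v (e i) a c"
      by (metis vol_swap(1,2) minus_minus)
    moreover have "vol (e i) a b ?v = - vol ?v (e i) a b"
      by (metis vol_swap minus_minus)
    ultimately show ?thesis
      using vol_cramer[of x "e i" ?v a b c] sk[of x "e i"] by (simp add: algebra_simps)
  qed
  then have "(\<Sum>i\<in>UNIV. ip x (e i) * vol (N (e i)) a b c - ip x a * vol (N (e i)) (e i) b c
      + ip x b * vol (N (e i)) (e i) a c - ip x c * vol (N (e i)) (e i) a b)
      = (\<Sum>i\<in>UNIV. - (ip (N x) (e i) * vol (e i) a b c))"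
    by simp
  then have "vol (N x) a b c + ip x a * \<eta> b c - ip x b * \<eta> a c + ip x c * \<eta> a b = - vol (N x) a b c"
    by (simp add: sum.distrib sum_subtractf sum_negf ex eN \<eta>_def flip: sum_distrib_left)
  then show ?thesis by simp
qed

end

section \<open>Three-forms and the Levi-Civita connection\<close>

lemma length_three: "length xs = 3 \<Longrightarrow> \<exists>a b c. xs = [a, b, c]"
  by (auto simp: numeral_3_eq_3 length_Suc_conv)

lemma alternating_three_form_iff:
  fixes \<omega> :: "'a::real_vector list \<Rightarrow> real"
  shows "alternating_form 3 \<omega> \<longleftrightarrow>
    (\<forall>b c. linear (\<lambda>a. \<omega> [a, b, c])) \<and> (\<forall>a c. linear (\<lambda>b. \<omega> [a, b, c])) \<and>
    (\<forall>a b. linear (\<lambda>c. \<omega> [a, b, c])) \<and>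
    (\<forall>a b. \<omega> [a, a, b] = 0 \<and> \<omega> [a, b, a] = 0 \<and> \<omega> [b, a, a] = 0)" (is "?L \<longleftrightarrow> ?R")
proof
  assume L: ?L
  have lin: "linear (\<lambda>v. \<omega> ([a, b, c][i := v]))" if "i < 3" for a b c i
    using L that unfolding alternating_form_def by (elim conjE) (erule allE[of _ "[a, b, c]"], simp)
  have alt: "\<omega> [a, b, c] = 0" if "i < j" "j < 3" "[a, b, c] ! i = [a, b, c] ! j" for a b c i j
    using L that unfolding alternating_form_def by (metis length_Cons list.size(3) numeral_3_eq_3)
  show ?R
    using lin[of 0] lin[of 1] lin[of 2] alt[of 0 1] alt[of 0 2] alt[of 1 2]
    by (simp add: numeral_2_eq_2)
next
  assume R: ?R
  show ?L
    unfolding alternating_form_def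
  proof (intro conjI allI impI)
    fix xs :: "'a list" and i :: nat
    assume l: "length xs = 3" and "i < 3"
    then consider "i = 0" | "i = 1" | "i = 2" by linarith
    then show "linear (\<lambda>v. \<omega> (xs[i := v]))"
      using length_three[OF l] R by cases (auto simp: numeral_2_eq_2)
  next
    fix xs :: "'a list" and i j :: nat
    assume l: "length xs = 3" and "i < j" "j < 3" and eq: "xs ! i = xs ! j"
    then consider "i = 0" "j = 1" | "i = 0" "j = 2" | "i = 1" "j = 2" by linarith
    then show "\<omega> xs = 0"
      using length_three[OF l] R eq by cases (auto simp: numeral_2_eq_2)
  qed
qed

context orthonormal_frame
begin

text \<open>Up to sign, an alternating function is unchanged by permutations, so the four increasing triples of frame
  vectors determine it.\<close>

lemma alternating_trilinear_zero:
  fixes T :: "'a \<Rightarrow> 'a \<Rightarrow> 'a \<Rightarrow> real"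
  assumes lin: "\<And>b c. linear (\<lambda>a. T a b c)" "\<And>a c. linear (\<lambda>b. T a b c)" "\<And>a b. linear (\<lambda>c. T a b c)"
    and alt: "\<And>a b. T a a b = 0" "\<And>a b. T a b a = 0" "\<And>a b. T b a a = 0"
    and frame: "T (e 0) (e 1) (e 2) = 0" "T (e 0) (e 1) (e 3) = 0"
      "T (e 0) (e 2) (e 3) = 0" "T (e 1) (e 2) (e 3) = 0"
  shows "T a b c = 0"
proof -
  have "T x y c + T y x c = T (x + y) (x + y) c" for x y c
    using alt(1)[of x c] alt(1)[of y c] by (simp add: linear_add[OF lin(1)] linear_add[OF lin(2)])
  then have sw1: "T y x c = 0 \<longleftrightarrow> T x y c = 0" for x y c
    by (metis alt(1) add.left_neutral add.right_neutral)
  have "T c x y + T c y x = T c (x + y) (x + y)" for x y c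
    using alt(3)[of c x] alt(3)[of c y] by (simp add: linear_add[OF lin(2)] linear_add[OF lin(3)])
  then have sw2: "T c y x = 0 \<longleftrightarrow> T c x y = 0" for x y c
    by (metis alt(3) add.left_neutral add.right_neutral)
  have basis: "\<forall>i j k. T (e i) (e j) (e k) = 0"
    using frame unfolding all_index4 by (simp add: alt sw1 sw2)
  have "T a b c = T (\<Sum>i\<in>UNIV. ip a (e i) *\<^sub>R e i) (\<Sum>i\<in>UNIV. ip b (e i) *\<^sub>R e i)
      (\<Sum>i\<in>UNIV. ip c (e i) *\<^sub>R e i)"
    by (simp only: expansion)
  also have "\<dots> = 0"
    by (simp add: basis linear_sum[OF lin(1)] linear_sum[OF lin(2)] linear_sum[OF lin(3)]
       linear_scale[OF lin(1)] linear_scale[OF lin(2)] linear_scale[OF lin(3)])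
  finally show ?thesis .
qed

lemma vol_repeat: "vol a x x b = 0" "vol a x b x = 0" "vol a b x x = 0"
  using vol_swap(2)[of a x x b] vol_swap(3)[of a b x x] vol_swap(2)[of a x b x] vol_swap(3)[of a x x b]
  by auto

text \<open>The Hodge isomorphism between vectors and 3-forms in dimension four. The coordinates of \<open>\<xi>\<close> are read off
  from the values of \<open>\<omega>\<close> on triples of frame vectors, as in \<open>vol_frame\<close>.\<close>

lemma hodge_dual_exists:
  assumes "alternating_form 3 \<omega>"
  shows "\<exists>\<xi>. \<forall>a b c. \<omega> [a, b, c] = vol \<xi> a b c"
proof -
  define \<xi> where "\<xi> = (\<Sum>i\<in>UNIV. quad (\<omega> [e 1, e 2, e 3]) (- \<omega> [e 0, e 2, e 3])
    (\<omega> [e 0, e 1, e 3]) (- \<omega> [e 0, e 1, e 2]) i *\<^sub>R e i)"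
  note alt = assms[unfolded alternating_three_form_iff]
  have "\<omega> [a, b, c] - vol \<xi> a b c = 0" for a b c
  proof (rule alternating_trilinear_zero[where T = "\<lambda>a b c. \<omega> [a, b, c] - vol \<xi> a b c"])
    show "linear (\<lambda>a. \<omega> [a, b, c] - vol \<xi> a b c)" "linear (\<lambda>b. \<omega> [a, b, c] - vol \<xi> a b c)"
      "linear (\<lambda>c. \<omega> [a, b, c] - vol \<xi> a b c)" for a b c
      using alt by (auto intro!: linear_compose_sub vol_linear)
  qed (use alt in \<open>simp_all add: vol_repeat vol_frame \<xi>_def ip_sum_frame\<close>)
  then show ?thesis by auto
qed

lemma hodge_dual_alternating:
  "alternating_form 3 (\<lambda>xs. vol \<xi> (xs ! 0) (xs ! 1) (xs ! 2))"
  by (simp add: alternating_three_form_iff vol_linear vol_repeat)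

end

locale metric_lie_algebra = orthonormal_frame ip e
  for ip :: "'a::real_vector \<Rightarrow> 'a \<Rightarrow> real" and e +
  fixes br :: "'a \<Rightarrow> 'a \<Rightarrow> 'a"
  assumes lie: "lie_algebra br"
begin

lemmas br_bilinear = lie_algebra_bilinear[OF lie]

lemmas br_simps [simp] =
  bilinear_ladd[OF br_bilinear] bilinear_radd[OF br_bilinear]
  bilinear_lneg[OF br_bilinear] bilinear_rneg[OF br_bilinear]
  bilinear_lmul[OF br_bilinear] bilinear_rmul[OF br_bilinear]

lemma br_self [simp]: "br x x = 0"
  using lie by (simp add: lie_algebra_def)

abbreviation nab where "nab \<equiv> levi_civita br ip"

lemma koszul: "2 * ip (nab x y) z = ip (br x y) z - ip (br y z) x + ip (br z x) y"
proof -
  define K where "K z = ip (br x y) z - ip (br y z) x + ip (br z x) y" for z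
  have Kl: "linear K" by (rule linearI) (simp_all add: K_def algebra_simps)
  define v where "v = (\<Sum>i\<in>UNIV. (K (e i) / 2) *\<^sub>R e i)"
  have v: "2 * ip v z = K z" for z
  proof -
    have "ip v z = (\<Sum>i\<in>UNIV. K (e i) / 2 * ip z (e i))"
      unfolding parseval[of v z] by (simp add: v_def ip_sum_frame)
    also have "\<dots> = K (\<Sum>i\<in>UNIV. ip z (e i) *\<^sub>R e i) / 2"
      by (simp add: linear_sum[OF Kl] linear_scale[OF Kl] sum_divide_distrib mult.commute)
    finally show ?thesis by (simp add: expansion)
  qed
  have "\<exists>!v. \<forall>z. 2 * ip v z = K z"
  proof (rule ex1I[of _ v])
    show "\<forall>z. 2 * ip v z = K z" using v by blast
  next
    fix v' assume "\<forall>z. 2 * ip v' z = K z"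
    then have "ip v' z = ip v z" for z using v[of z] by (metis mult_cancel_left zero_neq_numeral)
    then show "v' = v" by (rule vector_eqI)
  qed
  from theI'[OF this] show ?thesis
    unfolding levi_civita_def K_def by blast
qed

lemma nab_linear: "linear (\<lambda>x. nab x y)" "linear (\<lambda>y. nab x y)"
proof -
  have eqI: "v = w" if "\<And>z. 2 * ip v z = 2 * ip w z" for v w
    using that vector_eqI[of v w] by simp
  show "linear (\<lambda>x. nab x y)"
  proof (rule linearI; rule eqI)
    show "2 * ip (nab (a + b) y) z = 2 * ip (nab a y + nab b y) z" for a b z
      using koszul[of "a + b" y z] koszul[of a y z] koszul[of b y z] by simp
    have "2 * ip (nab (r *\<^sub>R a) y) z = r * (2 * ip (nab a y) z)" for r a z
      unfolding koszul by (simp add: algebra_simps)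
    then show "2 * ip (nab (r *\<^sub>R a) y) z = 2 * ip (r *\<^sub>R nab a y) z" for r a z by simp
  qed
  show "linear (\<lambda>y. nab x y)"
  proof (rule linearI; rule eqI)
    show "2 * ip (nab x (a + b)) z = 2 * ip (nab x a + nab x b) z" for a b z
      using koszul[of x "a + b" z] koszul[of x a z] koszul[of x b z] by simp
    have "2 * ip (nab x (r *\<^sub>R a)) z = r * (2 * ip (nab x a) z)" for r a z
      unfolding koszul by (simp add: algebra_simps)
    then show "2 * ip (nab x (r *\<^sub>R a)) z = 2 * ip (r *\<^sub>R nab x a) z" for r a z by simp
  qed
qed

lemma br_commute: "br y x = - br x y"
  using lie_algebra_anticommute[OF lie] .

lemma nab_torsion_free: "br x y = nab x y - nab y x"
proof (rule vector_eqI)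
  fix z
  have "2 * ip (nab x y - nab y x) z = 2 * ip (br x y) z"
    using koszul[of x y z] koszul[of y x z] br_commute[of y x] br_commute[of x z] br_commute[of y z]
    by simp
  then show "ip (br x y) z = ip (nab x y - nab y x) z" by simp
qed

lemma nab_metric: "ip (nab x y) y = 0"
  using koszul[of x y y] br_commute[of x y] by (simp add: ip_commute)

lemma nab_diagonal: "ip (nab x \<xi>) x = - ip (br \<xi> x) x"
  using koszul[of x \<xi> x] br_commute[of \<xi> x] by simp

text \<open>The Levi-Civita connection is metric, so \<open>\<nabla>\<^sub>x\<close> is skew-symmetric, hence traceless, and the derivation identity
  lets it pass through \<open>vol\<close>: it commutes with the Hodge isomorphism.\<close>

lemma nabla_hodge_dual:
  assumes "\<And>a b c. \<omega> [a, b, c] = vol \<xi> a b c"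
  shows "nabla br ip x \<omega> [a, b, c] = vol (nab x \<xi>) a b c"
proof -
  have "tr (nab x) = 0" by (rule tr_skew) (rule nab_metric)
  then show ?thesis
    using vol_derivation[OF nab_linear(2), of x \<xi> a b c]
    by (simp add: nabla_def assms numeral_3_eq_3 numeral_2_eq_2)
qed

text \<open>The exterior derivative of a 3-form is the divergence of the dual vector, which for a left-invariant vector
  is minus the trace of its adjoint map. As the connection is torsion-free, \<open>d \<omega>\<close> is the alternating sum of covariant
  derivatives; the derivation identity for \<open>y \<mapsto> \<nabla>\<^sub>y \<xi>\<close> then produces the trace. On a unimodular algebra every
  3-form is therefore closed.\<close>

lemma ext_d_hodge_dual:
  assumes "\<And>a b c. \<omega> [a, b, c] = vol \<xi> a b c"
  shows "ext_d br \<omega> [x, a, b, c] = - lin_trace (br \<xi>) * vol x a b c"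
proof -
  let ?N = "\<lambda>y. nab y \<xi>"
  have d: "ext_d br \<omega> [x, a, b, c] =
      - vol \<xi> (br x a) b c + vol \<xi> (br x b) a c - vol \<xi> (br x c) a b
      - vol \<xi> (br a b) x c + vol \<xi> (br a c) x b - vol \<xi> (br b c) x a"
    by (simp add: ext_d_def assms numeral_3_eq_3 numeral_2_eq_2 nths_Cons lessThan_Suc)
  have D: "vol (nab y \<xi>) p q r = - vol \<xi> (nab y p) q r - vol \<xi> p (nab y q) r - vol \<xi> p q (nab y r)"
    for y p q r
  proof -
    have "tr (nab y) = 0" by (rule tr_skew) (rule nab_metric)
    then show ?thesis using vol_derivation[OF nab_linear(2), of y \<xi> p q r] by simp
  qed
  have B: "vol \<xi> (br p q) r s = vol \<xi> (nab p q) r s - vol \<xi> (nab q p) r s" for p q r s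
    by (subst nab_torsion_free) (rule linear_diff[OF vol_linear(2)])
  \<comment> \<open>Torsion-freeness splits each bracket into two terms, and the twelve terms regroup, after these
    transpositions, into the four covariant derivatives.\<close>
  have s1: "vol \<xi> q p r = - vol \<xi> p q r" "vol \<xi> q r p = vol \<xi> p q r"  for p q r
    using vol_swap(2)[of \<xi> q p r] vol_swap(3)[of \<xi> q r p] by simp_all
  have "ext_d br \<omega> [x, a, b, c]
    = vol (?N x) a b c - vol (?N a) x b c + vol (?N b) x a c - vol (?N c) x a b"
    unfolding d B D
      s1(1)[of a "nab x b" c] s1(2)[of a b "nab x c"] s1(1)[of x "nab a b" c] s1(2)[of x b "nab a c"]
      s1(1)[of x "nab b a" c] s1(2)[of x a "nab b c"] s1(1)[of x "nab c a" b] s1(2)[of x a "nab c b"]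
    by simp
  also have "\<dots> = vol (?N x) a b c + vol x (?N a) b c + vol x a (?N b) c + vol x a b (?N c)"
    using vol_swap(1)[of x "?N a" b c] vol_swap(2)[of x a "?N b" c] vol_swap(1)[of x "?N b" a c]
      vol_swap(3)[of x a b "?N c"] vol_swap(2)[of x a "?N c" b] vol_swap(1)[of x "?N c" a b]
    by simp
  also have "\<dots> = tr ?N * vol x a b c"
    by (rule vol_derivation[OF nab_linear(1)])
  also have "tr ?N = - tr (br \<xi>)"
    by (simp add: tr_def nab_diagonal sum_negf)
  also have "tr (br \<xi>) = lin_trace (br \<xi>)"
    using br_bilinear by (intro tr_eq_lin_trace) (simp add: bilinear_def)
  finally show ?thesis .
qed

lemma wedge1_two_form:
  "wedge1 \<alpha> \<eta> [a, b, c] = \<alpha> a * \<eta> [b, c] - \<alpha> b * \<eta> [a, c] + \<alpha> c * \<eta> [a, b]"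
  by (simp add: wedge1_def numeral_3_eq_3 numeral_2_eq_2 nths_Cons lessThan_Suc)

end

section \<open>Existence of orthonormal frames\<close>

lemma orthonormal_independent:
  fixes ip :: "'a::real_vector \<Rightarrow> 'a \<Rightarrow> real"
  assumes "inner_product ip" "finite E"
    and on: "\<forall>u\<in>E. \<forall>v\<in>E. ip u v = (if u = v then 1 else 0)"
  shows "independent E"
proof (rule real_vector.independent_if_scalars_zero[OF assms(2)])
  have bil: "bilinear ip" using assms(1) by (simp add: inner_product_def)
  have lin: "linear (\<lambda>x. ip x y)" for y using bil by (simp add: bilinear_def)
  fix f v assume eq: "(\<Sum>x\<in>E. f x *\<^sub>R x) = 0" and v: "v \<in> E"
  have "0 = ip (\<Sum>x\<in>E. f x *\<^sub>R x) v"
    unfolding eq by (simp add: bilinear_lzero[OF bil])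
  also have "\<dots> = (\<Sum>x\<in>E. f x * ip x v)"
    by (simp add: linear_sum[OF lin] linear_scale[OF lin])
  also have "\<dots> = (\<Sum>x\<in>E. if x = v then f x else 0)"
    using on v by (intro sum.cong) auto
  also have "\<dots> = f v" using assms(2) v by simp
  finally show "f v = 0" by simp
qed

text \<open>Gram-Schmidt for an inner product given as a function, rather than by the type class.\<close>

lemma gram_schmidt:
  fixes ip :: "'a::real_vector \<Rightarrow> 'a \<Rightarrow> real"
  assumes ip: "inner_product ip" and "finite B"
  shows "\<exists>E. finite E \<and> (\<forall>u\<in>E. \<forall>v\<in>E. ip u v = (if u = v then 1 else 0)) \<and> span E = span B"
  using \<open>finite B\<close>
proof (induction B rule: finite_induct)
  case empty
  show ?case by (rule exI[of _ "{}"]) simp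
next
  case (insert b B)
  then obtain E where E: "finite E" "span E = span B"
    and on: "\<And>u v. u \<in> E \<Longrightarrow> v \<in> E \<Longrightarrow> ip u v = (if u = v then 1 else 0)" by blast
  have bil: "bilinear ip" and sym: "\<And>x y. ip x y = ip y x" and pos: "\<And>x. x \<noteq> 0 \<Longrightarrow> ip x x > 0"
    using ip by (auto simp: inner_product_def)
  have lin: "linear (\<lambda>x. ip x y)" for y using bil by (simp add: bilinear_def)
  define p where "p = (\<Sum>u\<in>E. ip b u *\<^sub>R u)"
  have p: "p \<in> span E"
    unfolding p_def by (intro real_vector.span_sum real_vector.span_scale real_vector.span_base)
  have orth: "ip (b - p) u = 0" if "u \<in> E" for u
  proof -
    have "ip p u = (\<Sum>v\<in>E. ip b v * ip v u)"
      by (simp add: p_def linear_sum[OF lin] linear_scale[OF lin])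
    also have "\<dots> = (\<Sum>v\<in>E. if v = u then ip b v else 0)"
      using on that by (intro sum.cong) auto
    finally show ?thesis using E that by (simp add: bilinear_lsub[OF bil])
  qed
  show ?case
  proof (cases "b - p = 0")
    case True
    then have "span (insert b B) = span B"
      using p E by (simp add: real_vector.span_redundant)
    then show ?thesis using E(2) by (intro exI[of _ E]) (simp add: on E(1))
  next
    case False
    define r where "r = 1 / sqrt (ip (b - p) (b - p))"
    define n where "n = r *\<^sub>R (b - p)"
    have r: "r \<noteq> 0" "r * r * ip (b - p) (b - p) = 1"
      using pos[OF False] by (auto simp: r_def)
    have nn: "ip n n = 1" using r by (simp add: n_def bilinear_lmul[OF bil] bilinear_rmul[OF bil])
    have nu: "ip n u = 0" if "u \<in> E" for u
      using orth[OF that] by (simp add: n_def bilinear_lmul[OF bil])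
    have "\<forall>u\<in>insert n E. \<forall>v\<in>insert n E. ip u v = (if u = v then 1 else 0)"
    proof (intro ballI)
      have new: "n \<notin> E" using nn nu by force
      fix u v assume "u \<in> insert n E" "v \<in> insert n E"
      then show "ip u v = (if u = v then 1 else 0)"
        using nn nu[of u] nu[of v] on[of u v] sym[of u v] new by (cases "u = n"; cases "v = n") auto
    qed
    moreover have "span (insert n E) = span (insert b B)"
    proof -
      have "span (insert n E) = span (insert b E)"
      proof (rule real_vector.span_eq[THEN iffD2], intro conjI)
        have "b = (1 / r) *\<^sub>R n + p" using r by (simp add: n_def)
        moreover have "p \<in> span (insert n E)" "n \<in> span (insert n E)"
          using p real_vector.span_mono[of E "insert n E"] by (auto intro: real_vector.span_base)
        ultimately have "b \<in> span (insert n E)"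
          by (metis real_vector.span_add real_vector.span_scale)
        then show "insert b E \<subseteq> span (insert n E)" by (auto intro: real_vector.span_base)
        have "p \<in> span (insert b E)" "b \<in> span (insert b E)"
          using p real_vector.span_mono[of E "insert b E"] by (auto intro: real_vector.span_base)
        then have "n \<in> span (insert b E)"
          unfolding n_def by (intro real_vector.span_scale real_vector.span_diff)
        then show "insert n E \<subseteq> span (insert b E)" by (auto intro: real_vector.span_base)
      qed
      then show ?thesis using E(2) by (simp add: real_vector.span_insert)
    qed
    ultimately show ?thesis using E(1) by (intro exI[of _ "insert n E"]) simp
  qed
qed

lemma orthonormal_frame_exists:
  fixes ip :: "'a::real_vector \<Rightarrow> 'a \<Rightarrow> real"
  assumes d: "dim (UNIV :: 'a set) = 4" and ip: "inner_product ip"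
  shows "\<exists>e. orthonormal_frame ip e \<and> range e = (SOME E. orthonormal_basis ip E)"
proof -
  obtain B :: "'a set" where B: "finite B" "independent B" "span B = UNIV" "card B = 4"
    using subspace_basis_extending[OF d real_vector.independent_empty, of UNIV] d by auto
  obtain E where E: "finite E" "\<forall>u\<in>E. \<forall>v\<in>E. ip u v = (if u = v then 1 else 0)" "span E = UNIV"
    using gram_schmidt[OF ip B(1)] B(3) by auto
  have "orthonormal_basis ip E"
    using E orthonormal_independent[OF ip] by (simp add: orthonormal_basis_def basis_of_space_def)
  then have on: "orthonormal_basis ip (SOME E. orthonormal_basis ip E)" (is "orthonormal_basis ip ?E")
    by (rule someI)
  then have bas: "basis_of_space ?E" by (simp add: orthonormal_basis_def)
  have "card ?E = 4"
    using basis_sets_finite_card[of B ?E] B bas by (simp add: basis_of_space_def)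
  then obtain e :: "4 \<Rightarrow> 'a" where e: "frame e" "range e = ?E"
    using frame_of_basis[where ?'i = 4, OF bas] by auto
  have "ip (e i) (e j) = (if e i = e j then 1 else 0)" for i j
    using on e(2) unfolding orthonormal_basis_def by (metis rangeI)
  moreover have "e i = e j \<longleftrightarrow> i = j" for i j using e(1) by (auto simp: frame_def dest: injD)
  ultimately have "orthonormal_frame ip e"
    using ip e by (simp add: orthonormal_frame_def)
  then show ?thesis using e(2) by blast
qed

section \<open>Strict conformal Killing forms and skew adjoint maps\<close>

context metric_lie_algebra
begin

text \<open>For skew \<open>ad \<xi>\<close> the Koszul formula collapses: \<open>\<nabla> \<xi>\<close> vanishes exactly when \<open>\<xi>\<close> is
  orthogonal to the derived algebra.\<close>
lemma nab_of_skew: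
  assumes skew: "\<And>x. ip (br \<xi> x) x = 0"
  shows "2 * ip (nab x \<xi>) y = ip \<xi> (br y x)"
  using koszul[of x \<xi> y] skew[of "x + y"] skew[of x] skew[of y] br_commute[of \<xi> x]
  by (simp add: ip_commute)

text \<open>The dual vector of a strict conformal Killing 3-form is a Killing vector that is not parallel. As \<open>d \<omega> = 0\<close>, the
  equation says that the 3-form dual to \<open>\<nabla>\<^sub>x \<xi>\<close> is a multiple of \<open>x\<^sup>* \<and> \<eta>\<close>; wedging it with \<open>x\<^sup>*\<close> gives
  \<open>ip (\<nabla>\<^sub>x \<xi>) x = 0\<close>, so that \<open>ad \<xi>\<close> is skew. Strictness says that \<open>\<nabla> \<xi> \<noteq> 0\<close>.\<close>
lemma strict_CKY_gives_skew:
  assumes d: "dim (UNIV :: 'a set) = 4" and uni: "unimodular br"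
    and \<omega>: "strict_CKY_form br ip 3 \<omega>"
  shows "\<exists>\<xi>. (\<forall>x. ip (br \<xi> x) x = 0) \<and> (\<exists>x y. ip \<xi> (br x y) \<noteq> 0)"
proof -
  have alt: "alternating_form 3 \<omega>"
    and cky: "\<And>x xs. length xs = 3 \<Longrightarrow> nabla br ip x \<omega> xs =
        1 / 4 * contract x (ext_d br \<omega>) xs - 1 / 2 * wedge1 (ip x) (codiff br ip \<omega>) xs"
    and nk: "\<not> killing_form br ip 3 \<omega>"
    using \<omega> d by (auto simp: strict_CKY_form_def conformal_killing_form_def)
  obtain \<xi> where \<xi>: "\<And>a b c. \<omega> [a, b, c] = vol \<xi> a b c"
    using hodge_dual_exists[OF alt] by blast
  have dw: "ext_d br \<omega> [x, a, b, c] = 0" for x a b c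
    using ext_d_hodge_dual[OF \<xi>] uni by (simp add: unimodular_def)
  define \<eta> where "\<eta> b c = codiff br ip \<omega> [b, c]" for b c
  have eq: "vol (nab x \<xi>) a b c = - (ip x a * \<eta> b c - ip x b * \<eta> a c + ip x c * \<eta> a b) / 2" for x a b c
    using cky[of "[a, b, c]" x]
    by (simp add: contract_def dw nabla_hodge_dual[OF \<xi>] wedge1_two_form \<eta>_def field_simps)
  have "ip (nab x \<xi>) x = 0" for x
  proof -
    note f = vol_frame[of "nab x \<xi>", unfolded eq]
    have "2 * ip (nab x \<xi>) x = 2 * (\<Sum>i\<in>UNIV. ip (nab x \<xi>) (e i) * ip x (e i))" by (simp only: parseval[of "nab x \<xi>" x])
    also have "\<dots> = 0"
    proof -
      have f': "2 * ip (nab x \<xi>) (e 0) =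
          - ip x (e 1) * \<eta> (e 2) (e 3) + ip x (e 2) * \<eta> (e 1) (e 3) - ip x (e 3) * \<eta> (e 1) (e 2)"
        "2 * ip (nab x \<xi>) (e 1) =
          ip x (e 0) * \<eta> (e 2) (e 3) - ip x (e 2) * \<eta> (e 0) (e 3) + ip x (e 3) * \<eta> (e 0) (e 2)"
        "2 * ip (nab x \<xi>) (e 2) =
          - ip x (e 0) * \<eta> (e 1) (e 3) + ip x (e 1) * \<eta> (e 0) (e 3) - ip x (e 3) * \<eta> (e 0) (e 1)"
        "2 * ip (nab x \<xi>) (e 3) =
          ip x (e 0) * \<eta> (e 1) (e 2) - ip x (e 1) * \<eta> (e 0) (e 2) + ip x (e 2) * \<eta> (e 0) (e 1)"
        using f by (simp_all add: field_simps)
      \<comment> \<open>This is \<open>x\<^sup>* \<and> x\<^sup>* \<and> \<eta> = 0\<close> in coordinates.\<close>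
      show ?thesis
        unfolding sum_index4 distrib_left mult.assoc[symmetric] f' by (simp add: algebra_simps)
    qed
    finally show ?thesis by simp
  qed
  then have skew: "ip (br \<xi> x) x = 0" for x
    using nab_diagonal[of x \<xi>] by simp
  have "\<exists>x. nab x \<xi> \<noteq> 0"
  proof (rule ccontr)
    assume "\<not> ?thesis"
    then have "nabla br ip x \<omega> [a, b, c] = 0" for x a b c
      using linear_0[OF vol_linear(1)] by (simp add: nabla_hodge_dual[OF \<xi>])
    then have "nabla br ip x \<omega> xs = 1 / (real 3 + 1) * contract x (ext_d br \<omega>) xs"
      if "length xs = 3" for x xs
      using length_three[OF that] by (auto simp: contract_def dw)
    then have "killing_form br ip 3 \<omega>"
      using alt by (simp add: killing_form_def)
    then show False using nk by simp
  qed
  then obtain x y where "ip (nab x \<xi>) y \<noteq> 0"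
    using vector_eqI[of _ 0] by (metis bilinear_lzero[OF ip_bilinear])
  then have "ip \<xi> (br y x) \<noteq> 0" using nab_of_skew[OF skew, of x y] by auto
  then show ?thesis using skew by blast
qed

text \<open>Conversely \<open>\<omega> = vol \<xi>\<close> works: it is closed because a skew map has trace zero, \<open>vol_skew\<close> for \<open>N = \<nabla> \<xi>\<close> is the
  conformal Killing equation, and its 2-form is the codifferential. The definition of \<open>codiff\<close> sums over one selected
  orthonormal basis, and the frame is required to enumerate that basis so that no change of basis is needed.\<close>

lemma skew_gives_strict_CKY:
  assumes d: "dim (UNIV :: 'a set) = 4" and e: "range e = (SOME E. orthonormal_basis ip E)"
    and skew: "\<And>x. ip (br \<xi> x) x = 0" and pq: "ip \<xi> (br p q) \<noteq> 0"
  shows "\<exists>\<omega>. strict_CKY_form br ip 3 \<omega>"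
proof -
  define \<omega> where "\<omega> xs = vol \<xi> (xs ! 0) (xs ! 1) (xs ! 2)" for xs
  have alt: "alternating_form 3 \<omega>"
    using hodge_dual_alternating[of \<xi>] by (simp add: \<omega>_def[abs_def])
  have \<xi>: "\<omega> [a, b, c] = vol \<xi> a b c" for a b c by (simp add: \<omega>_def numeral_2_eq_2)
  have "lin_trace (br \<xi>) = 0"
    using tr_skew[OF skew] br_bilinear tr_eq_lin_trace[of "br \<xi>"] by (simp add: bilinear_def)
  then have dw: "ext_d br \<omega> [x, a, b, c] = 0" for x a b c
    using ext_d_hodge_dual[OF \<xi>] by simp
  have inj: "inj e" using frame by (simp add: frame_def)
  have cod: "codiff br ip \<omega> [b, c] = - (\<Sum>i\<in>UNIV. vol (nab (e i) \<xi>) (e i) b c)" for b c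
    unfolding codiff_def Let_def e[symmetric]
    by (simp add: sum.reindex[OF inj] contract_def nabla_hodge_dual[OF \<xi>])
  have nsk: "ip (nab x \<xi>) x = 0" for x
    using nab_diagonal[of x \<xi>] skew by simp
  have "nabla br ip x \<omega> xs = 1 / (real 3 + 1) * contract x (ext_d br \<omega>) xs
      - 1 / (real (dim (UNIV :: 'a set)) - real 3 + 1) * wedge1 (ip x) (codiff br ip \<omega>) xs"
    if len: "length xs = 3" for x xs
  proof -
    obtain a b c where xs: "xs = [a, b, c]" using length_three[OF len] by blast
    show ?thesis
      unfolding xs contract_def dw wedge1_two_form nabla_hodge_dual[OF \<xi>] cod d
        vol_skew[OF nab_linear(1) nsk, of x a b c] by (simp add: field_simps)
  qed
  then have "conformal_killing_form br ip 3 \<omega>"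
    using alt by (simp add: conformal_killing_form_def)
  moreover have "\<not> killing_form br ip 3 \<omega>"
  proof
    assume "killing_form br ip 3 \<omega>"
    then have "nabla br ip q \<omega> [a, b, c] = 1 / 4 * contract q (ext_d br \<omega>) [a, b, c]" for a b c
      by (auto simp: killing_form_def)
    then have "vol (nab q \<xi>) a b c = 0" for a b c
      by (simp add: nabla_hodge_dual[OF \<xi>] contract_def dw)
    then have "nab q \<xi> = 0" by (rule vol_nondegenerate)
    then show False using nab_of_skew[OF skew, of q p] pq by simp
  qed
  ultimately show ?thesis by (auto simp: strict_CKY_form_def)
qed

text \<open>If \<open>\<xi>\<close> were outside the abelian ideal \<open>I\<close>, the algebra would be spanned by \<open>\<xi>\<close> and \<open>I\<close>, every bracket would be of
  the form \<open>[\<xi>, y]\<close>, and skewness would make it orthogonal to \<open>\<xi>\<close>. For \<open>\<xi> \<in> I\<close> the image of \<open>ad \<xi>\<close> lies in \<open>I\<close>, on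
  which \<open>ad \<xi>\<close> vanishes, and a skew map whose square is zero is zero.\<close>

lemma skew_gives_central:
  assumes d: "dim (UNIV :: 'a set) = 4"
    and I: "lie_ideal br I" "\<And>x y. x \<in> I \<Longrightarrow> y \<in> I \<Longrightarrow> br x y = 0"
      "dim I + 1 = dim (UNIV :: 'a set)"
    and skew: "\<And>x. ip (br \<xi> x) x = 0" and pq: "ip \<xi> (br p q) \<noteq> 0"
  shows "\<xi> \<in> I \<and> (\<forall>x. br \<xi> x = 0)"
proof -
  have sk: "ip (br \<xi> x) y = - ip x (br \<xi> y)" for x y
    using skew[of "x + y"] skew[of x] skew[of y] by (simp add: ip_commute)
  have sub: "subspace I" and id: "\<And>x y. y \<in> I \<Longrightarrow> br x y \<in> I"
    using I(1) by (auto simp: lie_ideal_def)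
  have \<xi>I: "\<xi> \<in> I"
  proof (rule ccontr)
    assume n: "\<xi> \<notin> I"
    obtain s t where "p - s *\<^sub>R \<xi> \<in> I" "q - t *\<^sub>R \<xi> \<in> I"
      using codim_one_decomposition[OF d sub I(3) n] by metis
    then obtain p' q' where p': "p' \<in> I" "p = s *\<^sub>R \<xi> + p'" and q': "q' \<in> I" "q = t *\<^sub>R \<xi> + q'"
      by (metis add.commute diff_add_cancel)
    have "br p q = br \<xi> (s *\<^sub>R q' - t *\<^sub>R p')"
      using I(2)[OF p'(1) q'(1)] br_commute[of \<xi> p']
      by (simp add: p'(2) q'(2) bilinear_rsub[OF br_bilinear])
    then have "ip \<xi> (br p q) = 0" using sk[of \<xi> "s *\<^sub>R q' - t *\<^sub>R p'"] bilinear_lzero[OF ip_bilinear] by simp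
    then show False using pq by simp
  qed
  have "br \<xi> x = 0" for x
  proof -
    have "br \<xi> x \<in> I" using id[OF \<xi>I, of x] br_commute[of \<xi> x] sub
      by (simp add: real_vector.subspace_neg)
    then have "ip (br \<xi> x) (br \<xi> x) = 0"
      using sk[of x "br \<xi> x"] I(2)[OF \<xi>I, of "br \<xi> x"] by simp
    then show ?thesis using ip_pos[of "br \<xi> x"] by force
  qed
  then show ?thesis using \<xi>I by blast
qed

end

section \<open>Classification of the algebras with a central element in the ideal\<close>

lemma frame_quad_iff:
  assumes "dim (UNIV :: 'a::real_vector set) = 4"
  shows "frame (quad w x y (z::'a)) \<longleftrightarrow> (\<forall>s a b c. s *\<^sub>R w + a *\<^sub>R x + b *\<^sub>R y + c *\<^sub>R z = 0
    \<longrightarrow> s = 0 \<and> a = 0 \<and> b = 0 \<and> c = 0)" (is "_ \<longleftrightarrow> ?R")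
proof
  assume f: "frame (quad w x y z)"
  show ?R
  proof (intro allI impI)
    fix s a b c assume "s *\<^sub>R w + a *\<^sub>R x + b *\<^sub>R y + c *\<^sub>R z = 0"
    then have 0: "(\<Sum>i\<in>UNIV. quad s a b c i *\<^sub>R quad w x y z i) = 0" by (simp add: sum_index4)
    have "quad s a b c j = 0" for j
      using frame_coordinates[OF f, of "quad s a b c" j] frame_coordinates[OF f, of "\<lambda>_. 0" j]
      unfolding 0 by simp
    from this[of 0] this[of 1] this[of 2] this[of 3]
    show "s = 0 \<and> a = 0 \<and> b = 0 \<and> c = 0" by simp
  qed
next
  assume ?R
  then show "frame (quad w x y z)"
    by (intro frameI_independent assms) (simp add: sum_index4 all_index4)
qed

lemma frame_quad_expansion:
  assumes "frame (quad w x y (z::'a::real_vector))"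
  shows "\<exists>s a b c. v = s *\<^sub>R w + a *\<^sub>R x + b *\<^sub>R y + c *\<^sub>R z"
  using frame_expansion[OF assms, of v] unfolding sum_index4 by (metis quad_simps)

lemma lin_trace_quad:
  assumes l: "linear f" and fr: "frame (quad w x y (z::'a::real_vector))"
    and f: "f w = s0 *\<^sub>R w + a0 *\<^sub>R x + b0 *\<^sub>R y + c0 *\<^sub>R z"
      "f x = s1 *\<^sub>R w + a1 *\<^sub>R x + b1 *\<^sub>R y + c1 *\<^sub>R z"
      "f y = s2 *\<^sub>R w + a2 *\<^sub>R x + b2 *\<^sub>R y + c2 *\<^sub>R z"
      "f z = s3 *\<^sub>R w + a3 *\<^sub>R x + b3 *\<^sub>R y + c3 *\<^sub>R z"
  shows "lin_trace f = s0 + a1 + b2 + c3"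
proof -
  define M where "M i j = quad (quad s0 a0 b0 c0 i) (quad s1 a1 b1 c1 i) (quad s2 a2 b2 c2 i)
    (quad s3 a3 b3 c3 i) j" for i j
  have "\<forall>j. f (quad w x y z j) = (\<Sum>i\<in>UNIV. M i j *\<^sub>R quad w x y z i)"
    unfolding all_index4 sum_index4 by (simp add: M_def f)
  from lin_trace_frame[OF l fr, of M] this show ?thesis
    unfolding sum_index4 by (simp add: M_def)
qed

lemma isomorphic_from_brackets:
  fixes br :: "'a::real_vector \<Rightarrow> 'a \<Rightarrow> 'a"
  assumes br: "lie_algebra br" and fr: "frame (quad w x y z)"
    and ab: "br x y = 0" "br x z = 0" "br y z = 0"
  shows "br w x = 0 \<Longrightarrow> br w y = 0 \<Longrightarrow> br w z = y \<Longrightarrow> lie_isomorphic br h3_R"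
    and "br w x = 0 \<Longrightarrow> br w y = x \<Longrightarrow> br w z = y \<Longrightarrow> lie_isomorphic br n4"
    and "br w x = x \<Longrightarrow> br w y = - y \<Longrightarrow> br w z = 0 \<Longrightarrow> lie_isomorphic br r3m1_R"
    and "br w x = 0 \<Longrightarrow> br w y = z \<Longrightarrow> br w z = - y \<Longrightarrow> lie_isomorphic br euclid2_R"
  using ab
  by (auto intro!: lie_isomorphic_from_quad[OF br _ fr] lie_algebra_models
      simp: model_brackets sum_index4) (simp_all add: be_def axis_def)

text \<open>Let \<open>A = ad w\<close> for some \<open>w\<close> outside \<open>I\<close>; it acts on \<open>I\<close> with trace zero and kills \<open>u\<close>. If some \<open>p \<in> I\<close> is cyclic
  modulo \<open>u\<close>, then \<open>u, p, q = A p\<close> is a basis of \<open>I\<close> and the trace condition leaves \<open>A q = \<beta> u + c p\<close>. The number \<open>c\<close> is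
  the square of the nonzero eigenvalues: its sign separates \<open>r3m1_R\<close> from \<open>euclid2_R\<close>, and for \<open>c = 0\<close> the map is
  nilpotent, of order three (\<open>n4\<close>) or two (\<open>h3_R\<close>) according to \<open>\<beta>\<close>. If no such \<open>p\<close> exists, \<open>A\<close> is scalar modulo
  \<open>u\<close>, hence zero modulo \<open>u\<close> by the trace condition, and only \<open>h3_R\<close> is left.\<close>

lemma almost_abelian_classification:
  fixes br :: "'a::real_vector \<Rightarrow> 'a \<Rightarrow> 'a"
  assumes br: "lie_algebra br" and d: "dim (UNIV :: 'a set) = 4" and uni: "unimodular br"
    and I: "lie_ideal br I" "\<And>x y. x \<in> I \<Longrightarrow> y \<in> I \<Longrightarrow> br x y = 0"
      "dim I + 1 = dim (UNIV :: 'a set)"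
    and u: "u \<in> I" "u \<noteq> 0" "\<And>x. br u x = 0" and nonab: "br x0 y0 \<noteq> 0"
  shows "lie_isomorphic br h3_R \<or> lie_isomorphic br n4 \<or>
    lie_isomorphic br r3m1_R \<or> lie_isomorphic br euclid2_R"
proof -
  note bil = lie_algebra_bilinear[OF br]
  note bs = bilinear_ladd[OF bil] bilinear_radd[OF bil] bilinear_rsub[OF bil]
    bilinear_rneg[OF bil] bilinear_lmul[OF bil] bilinear_rmul[OF bil]
  have self: "br x x = 0" for x using br by (simp add: lie_algebra_def)
  have sub: "subspace I" and id: "\<And>x y. y \<in> I \<Longrightarrow> br x y \<in> I"
    using I(1) by (auto simp: lie_ideal_def)
  note subI = real_vector.subspace_add[OF sub] real_vector.subspace_diff[OF sub]
    real_vector.subspace_scale[OF sub]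
  obtain w where w: "w \<notin> I"
  proof -
    have "I \<noteq> UNIV" using I(3) by auto
    then show thesis using that by blast
  qed
  define A where "A = br w"
  have Al: "linear A" using bil by (simp add: A_def bilinear_def)
  note As = linear_add[OF Al] linear_diff[OF Al] linear_scale[OF Al] linear_neg[OF Al]
  have Au: "A u = 0" using lie_algebra_anticommute[OF br, of u w] u(3) by (simp add: A_def)
  have Aw: "A w = 0" by (simp add: A_def self)
  have AI: "A x \<in> I" if "x \<in> I" for x using id[OF that] by (simp add: A_def)
  have trA: "lin_trace A = 0" using uni by (simp add: unimodular_def A_def)
  have wI: "s = 0" if "s *\<^sub>R w \<in> I" for s
  proof (rule ccontr)
    assume "s \<noteq> 0"
    then show False using subI(3)[OF that, of "1 / s"] w by simp
  qed
  have fr: "frame (quad w x y z)" if "x \<in> I" "y \<in> I" "z \<in> I"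
    and ind: "\<And>a b c. a *\<^sub>R x + b *\<^sub>R y + c *\<^sub>R z = 0 \<Longrightarrow> a = 0 \<and> b = 0 \<and> c = 0" for x y z
    unfolding frame_quad_iff[OF d]
  proof (intro allI impI)
    fix s a b c assume 0: "s *\<^sub>R w + a *\<^sub>R x + b *\<^sub>R y + c *\<^sub>R z = 0"
    then have "s *\<^sub>R w = - (a *\<^sub>R x + b *\<^sub>R y + c *\<^sub>R z)"
      unfolding eq_neg_iff_add_eq_0 by (simp only: add.assoc)
    also have "\<dots> \<in> I" by (intro real_vector.subspace_neg sub subI that)
    finally have "s = 0" by (rule wI)
    then show "s = 0 \<and> a = 0 \<and> b = 0 \<and> c = 0" using 0 ind[of a b c] by simp
  qed
  show ?thesis
  proof (cases "\<exists>p\<in>I. \<forall>a b. A p \<noteq> a *\<^sub>R u + b *\<^sub>R p")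
    case True
    then obtain p where p: "p \<in> I" and n: "\<And>a b. A p \<noteq> a *\<^sub>R u + b *\<^sub>R p" by blast
    define q where "q = A p"
    have q: "q \<in> I" using AI[OF p] by (simp add: q_def)
    have q0: "q \<noteq> 0" using n[of 0 0] by (simp add: q_def)
    have upq: "frame (quad w u p q)"
    proof (rule fr)
      fix a b c assume 0: "a *\<^sub>R u + b *\<^sub>R p + c *\<^sub>R q = 0"
      have c: "c = 0"
      proof (rule ccontr)
        assume "c \<noteq> 0"
        have "c *\<^sub>R q = (-a) *\<^sub>R u + (-b) *\<^sub>R p" using 0 by (simp add: algebra_simps eq_neg_iff_add_eq_0)
        then have "(1 / c) *\<^sub>R c *\<^sub>R q = (1 / c) *\<^sub>R ((-a) *\<^sub>R u + (-b) *\<^sub>R p)" by simp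
        then have "q = (- a / c) *\<^sub>R u + (- b / c) *\<^sub>R p"
          using \<open>c \<noteq> 0\<close> by (simp add: scaleR_add_right scaleR_diff_right)
        then show False using n[of "- a / c" "- b / c"] by (simp add: q_def)
      qed
      then have "A (a *\<^sub>R u + b *\<^sub>R p) = 0" using 0 linear_0[OF Al] by simp
      then have b: "b = 0" using q0 by (simp add: As Au q_def)
      then show "a = 0 \<and> b = 0 \<and> c = 0" using 0 c u(2) by simp
    qed (use u p q in auto)
    note ind = upq[unfolded frame_quad_iff[OF d], rule_format]
    obtain s \<beta> c r where Aq0: "A q = s *\<^sub>R w + \<beta> *\<^sub>R u + c *\<^sub>R p + r *\<^sub>R q"
      using frame_quad_expansion[OF upq] by blast
    have s: "s = 0"
    proof (rule wI)
      have "s *\<^sub>R w = A q - (\<beta> *\<^sub>R u + c *\<^sub>R p + r *\<^sub>R q)" using Aq0 by simp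
      also have "\<dots> \<in> I" by (intro subI AI u p q)
      finally show "s *\<^sub>R w \<in> I" .
    qed
    have "lin_trace A = 0 + 0 + 0 + r"
      by (rule lin_trace_quad[OF Al upq, of 0 0 0 0 0 0 0 0 0 0 0 1 s \<beta> c])
        (simp_all add: Aw Au q_def[symmetric] Aq0)
    then have Aq: "A q = \<beta> *\<^sub>R u + c *\<^sub>R p" using trA Aq0 s by simp
    show ?thesis
    proof (cases "c = 0")
      case c: True
      show ?thesis
      proof (cases "\<beta> = 0")
        case True
        have "s = 0 \<and> x = 0 \<and> y = 0 \<and> z = 0"
          if "s *\<^sub>R w + x *\<^sub>R u + y *\<^sub>R q + z *\<^sub>R p = 0" for s x y z
          using ind[of s x z y] that by (simp add: ac_simps)
        then have fr': "frame (quad w u q p)" unfolding frame_quad_iff[OF d] by blast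
        have "lie_isomorphic br h3_R"
          by (rule isomorphic_from_brackets(1)[OF br fr'])
            (use I(2)[OF q p] u in \<open>simp_all add: A_def[symmetric] Au Aq c True q_def[symmetric]\<close>)
        then show ?thesis by blast
      next
        case False
        have fr': "frame (quad w (\<beta> *\<^sub>R u) q p)"
          unfolding frame_quad_iff[OF d]
        proof (intro allI impI)
          fix s x y z assume "s *\<^sub>R w + x *\<^sub>R \<beta> *\<^sub>R u + y *\<^sub>R q + z *\<^sub>R p = 0"
          then have "s *\<^sub>R w + (x * \<beta>) *\<^sub>R u + z *\<^sub>R p + y *\<^sub>R q = 0" by (simp add: ac_simps)
          from ind[OF this] False show "s = 0 \<and> x = 0 \<and> y = 0 \<and> z = 0" by simp
        qed
        have "lie_isomorphic br n4"
          by (rule isomorphic_from_brackets(2)[OF br fr'])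
            (use I(2)[OF q p] u in \<open>simp_all add: bs A_def[symmetric] As Au Aq c q_def[symmetric]\<close>)
        then show ?thesis by blast
      qed
    next
      case c: False
      \<comment> \<open>Moving \<open>p\<close> along the kernel of \<open>A\<close> removes the \<open>u\<close>-component of \<open>A q\<close>; rescaling \<open>w\<close> by \<open>l\<close> then
        makes the eigenvalues of absolute value one.\<close>
      define p' where "p' = p + (\<beta> / c) *\<^sub>R u"
      have p': "p' \<in> I" by (simp add: p'_def subI p u)
      have Ap': "A p' = q" by (simp add: p'_def As Au q_def)
      have Aq': "A q = c *\<^sub>R p'" using c by (simp add: p'_def Aq scaleR_add_right)
      define l where "l = sqrt \<bar>c\<bar>"
      have l: "l > 0" "l * l = \<bar>c\<bar>" using c by (auto simp: l_def)
      define w' where "w' = (1 / l) *\<^sub>R w"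
      define r where "r = (1 / l) *\<^sub>R q"
      have br': "br w' x = (1 / l) *\<^sub>R A x" for x by (simp add: w'_def A_def bs)
      have rI: "r \<in> I" by (simp add: r_def subI q)
      have ind': "s = 0 \<and> x = 0 \<and> y = 0 \<and> z = 0"
        if "s *\<^sub>R w' + x *\<^sub>R p' + y *\<^sub>R r + z *\<^sub>R u = 0" for s x y z
      proof -
        have "(s / l) *\<^sub>R w + (z + x * \<beta> / c) *\<^sub>R u + x *\<^sub>R p + (y / l) *\<^sub>R q = 0"
          using that by (simp add: w'_def p'_def r_def algebra_simps)
        from ind[OF this] l show ?thesis by auto
      qed
      have brp: "br w' p' = r" by (simp add: br' Ap' r_def)
      have brr: "br w' r = (c / (l * l)) *\<^sub>R p'" by (simp add: br' r_def As Aq')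
      have bru: "br w' u = 0" by (simp add: br' Au)
      show ?thesis
      proof (cases "c > 0")
        case True
        \<comment> \<open>\<open>ad w'\<close> interchanges \<open>p'\<close> and \<open>r\<close>, so \<open>p' + r\<close> and \<open>p' - r\<close> are eigenvectors for \<open>1\<close> and \<open>-1\<close>.\<close>
        have brr': "br w' r = p'" using brr l True by simp
        have fr': "frame (quad w' (p' + r) (p' - r) u)"
          unfolding frame_quad_iff[OF d]
        proof (intro allI impI)
          fix s x y z assume "s *\<^sub>R w' + x *\<^sub>R (p' + r) + y *\<^sub>R (p' - r) + z *\<^sub>R u = 0"
          then have "s *\<^sub>R w' + (x + y) *\<^sub>R p' + (x - y) *\<^sub>R r + z *\<^sub>R u = 0"
            by (simp add: algebra_simps)
          from ind'[OF this] show "s = 0 \<and> x = 0 \<and> y = 0 \<and> z = 0" by simp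
        qed
        have "lie_isomorphic br r3m1_R"
          by (rule isomorphic_from_brackets(3)[OF br fr'])
            (use I(2) subI p' rI u in \<open>simp_all add: bs brp brr' bru\<close>)
        then show ?thesis by blast
      next
        case False
        have brr': "br w' r = - p'" using brr l False c by (simp add: abs_if)
        have fr': "frame (quad w' u p' r)"
          unfolding frame_quad_iff[OF d]
        proof (intro allI impI)
          fix s x y z assume "s *\<^sub>R w' + x *\<^sub>R u + y *\<^sub>R p' + z *\<^sub>R r = 0"
          then have "s *\<^sub>R w' + y *\<^sub>R p' + z *\<^sub>R r + x *\<^sub>R u = 0" by (simp add: ac_simps)
          from ind'[OF this] show "s = 0 \<and> x = 0 \<and> y = 0 \<and> z = 0" by simp
        qed
        have "lie_isomorphic br euclid2_R"
          by (rule isomorphic_from_brackets(4)[OF br fr'])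
            (use I(2) p' rI u in \<open>simp_all add: brp brr' bru\<close>)
        then show ?thesis by blast
      qed
    qed
  next
    case False
    then have span: "\<And>p. p \<in> I \<Longrightarrow> \<exists>a b. A p = a *\<^sub>R u + b *\<^sub>R p" by blast
    obtain C where C: "{u} \<subseteq> C" "finite C" "independent C" "span C = I" "card C = 3"
      using subspace_basis_extending[OF d _ _ sub, of "{u}"] u I(3) d by auto
    have "card (C - {u}) = 2" using C by simp
    then obtain p q where pq: "C - {u} = {p, q}" "p \<noteq> q" by (auto simp: card_2_iff)
    then have Cupq: "C = {u, p, q}" and dist: "u \<noteq> p" "u \<noteq> q" using C(1) by auto
    have p: "p \<in> I" and q: "q \<in> I" using C(4) Cupq real_vector.span_base[of _ C] by auto
    have upq: "frame (quad w u p q)"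
    proof (rule fr)
      fix a b c assume 0: "a *\<^sub>R u + b *\<^sub>R p + c *\<^sub>R q = 0"
      define f where "f v = (if v = u then a else if v = p then b else c)" for v
      have "(\<Sum>v\<in>C. f v *\<^sub>R v) = 0"
        using 0 dist pq(2) by (simp add: Cupq f_def add.assoc)
      then have "f v = 0" if "v \<in> C" for v
        using C(2,3) that real_vector.independentD[of C C f v] by auto
      from this[of u] this[of p] this[of q] show "a = 0 \<and> b = 0 \<and> c = 0"
        using dist pq(2) by (auto simp: Cupq f_def)
    qed (use u p q in auto)
    note ind = upq[unfolded frame_quad_iff[OF d], rule_format]
    obtain \<alpha> a where Ap: "A p = \<alpha> *\<^sub>R u + a *\<^sub>R p" using span[OF p] by blast
    obtain \<beta> b where Aq: "A q = \<beta> *\<^sub>R u + b *\<^sub>R q" using span[OF q] by blast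
    \<comment> \<open>Since \<open>p + q\<close> is an eigenvector modulo \<open>u\<close> too, the two eigenvalues agree.\<close>
    obtain \<gamma> g where "A (p + q) = \<gamma> *\<^sub>R u + g *\<^sub>R (p + q)" using span[of "p + q"] subI(1)[OF p q] by blast
    then have "0 *\<^sub>R w + (\<alpha> + \<beta> - \<gamma>) *\<^sub>R u + (a - g) *\<^sub>R p + (b - g) *\<^sub>R q = 0"
      by (simp add: As Ap Aq algebra_simps)
    from ind[OF this] have "a = b" by simp
    moreover have "lin_trace A = 0 + 0 + a + b"
      by (rule lin_trace_quad[OF Al upq, of 0 0 0 0 0 0 0 0 0 \<alpha> a 0 0 \<beta> 0]) (simp_all add: Aw Au Ap Aq)
    ultimately have ab: "a = 0" "b = 0" using trA by auto
    note Ap' = Ap[unfolded ab] and Aq' = Aq[unfolded ab]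
    have nz: "\<alpha> \<noteq> 0 \<or> \<beta> \<noteq> 0"
    proof (rule ccontr)
      assume "\<not> ?thesis"
      then have Apq: "br w u = 0" "br w p = 0" "br w q = 0"
        using Ap' Aq' Au by (simp_all add: A_def)
      note anti = lie_algebra_anticommute[OF br]
      have Apq': "br u w = 0" "br p w = 0" "br q w = 0"
        using Apq anti[of u w] anti[of p w] anti[of q w] by simp_all
      obtain s1 a1 b1 c1 where "x0 = s1 *\<^sub>R w + a1 *\<^sub>R u + b1 *\<^sub>R p + c1 *\<^sub>R q"
        using frame_quad_expansion[OF upq] by blast
      moreover obtain s2 a2 b2 c2 where "y0 = s2 *\<^sub>R w + a2 *\<^sub>R u + b2 *\<^sub>R p + c2 *\<^sub>R q"
        using frame_quad_expansion[OF upq] by blast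
      ultimately have "br x0 y0 = 0" using u p q by (simp add: bs self Apq Apq' I(2))
      then show False using nonab by simp
    qed
    have h3: "lie_isomorphic br h3_R"
      if Av: "A v = 0" "v \<in> I" and z: "z \<in> I" "A z = \<delta> *\<^sub>R u" "\<delta> \<noteq> 0"
        and fr: "frame (quad w v (\<delta> *\<^sub>R u) z)" for v z \<delta>
      by (rule isomorphic_from_brackets(1)[OF br fr])
        (use that u I(2) in \<open>simp_all add: A_def[symmetric] subI As Au\<close>)
    show ?thesis
    proof (cases "\<alpha> = 0")
      case True
      have "frame (quad w p (\<beta> *\<^sub>R u) q)"
        unfolding frame_quad_iff[OF d]
      proof (intro allI impI)
        fix s x y z assume "s *\<^sub>R w + x *\<^sub>R p + y *\<^sub>R \<beta> *\<^sub>R u + z *\<^sub>R q = 0"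
        then have "s *\<^sub>R w + (y * \<beta>) *\<^sub>R u + x *\<^sub>R p + z *\<^sub>R q = 0" by (simp add: ac_simps)
        from ind[OF this] show "s = 0 \<and> x = 0 \<and> y = 0 \<and> z = 0" using nz True by simp
      qed
      then show ?thesis using h3[of p q \<beta>] Ap' Aq' True nz p q by simp
    next
      case False
      have "frame (quad w (q - (\<beta> / \<alpha>) *\<^sub>R p) (\<alpha> *\<^sub>R u) p)"
        unfolding frame_quad_iff[OF d]
      proof (intro allI impI)
        fix s x y z assume "s *\<^sub>R w + x *\<^sub>R (q - (\<beta> / \<alpha>) *\<^sub>R p) + y *\<^sub>R \<alpha> *\<^sub>R u + z *\<^sub>R p = 0"
        then have "s *\<^sub>R w + (y * \<alpha>) *\<^sub>R u + (z - x * \<beta> / \<alpha>) *\<^sub>R p + x *\<^sub>R q = 0"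
          by (simp add: algebra_simps)
        from ind[OF this] show "s = 0 \<and> x = 0 \<and> y = 0 \<and> z = 0" using False by auto
      qed
      then show ?thesis
        using h3[of "q - (\<beta> / \<alpha>) *\<^sub>R p" p \<alpha>] Ap' Aq' False p q by (simp add: As subI)
    qed
  qed
qed

section \<open>Inner products on the models\<close>

lemma model_central_nonabelian:
  assumes "m \<in> {h3_R, n4, r3m1_R, euclid2_R}"
  shows "\<exists>c p q. c \<noteq> 0 \<and> (\<forall>y. m c y = 0) \<and> m p q \<noteq> 0"
proof -
  have nz: "be i \<noteq> 0" for i by (simp add: be_def axis_eq_0_iff)
  have c: "h3_R (be 2) y = 0" "n4 (be 1) y = 0" "r3m1_R (be 3) y = 0" "euclid2_R (be 1) y = 0" for y
    by (simp_all add: h3_R_def n4_def r3m1_R_def euclid2_R_def minor_def be_def axis_def)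
  have "h3_R (be 0) (be 3) \<noteq> 0" "n4 (be 0) (be 2) \<noteq> 0" "r3m1_R (be 0) (be 1) \<noteq> 0"
    "euclid2_R (be 0) (be 2) \<noteq> 0"
    by (simp_all add: model_brackets nz)
  then show ?thesis using assms c nz by blast
qed

text \<open>If \<open>u\<close> and \<open>v\<close> are orthogonal, adding the square of the functional \<open>y \<mapsto> \<langle>y, u + v\<rangle>\<close> to the inner product
  makes them non-orthogonal.\<close>

lemma adapted_inner_product:
  fixes f :: "'a::real_vector \<Rightarrow> 'b::real_inner"
  assumes f: "linear f" "inj f" and "u \<noteq> (0::'a)" "v \<noteq> (0::'a)"
  shows "\<exists>ip. inner_product ip \<and> ip u v \<noteq> 0"
proof -
  have f0: "f x \<noteq> 0" if "x \<noteq> 0" for x using f that by (metis injD linear_0)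
  have ip: "inner_product (\<lambda>x y. f x \<bullet> f y + r * ((f x \<bullet> c) * (f y \<bullet> c)))" if "r \<ge> 0" for c r
    unfolding inner_product_def bilinear_def
  proof (intro conjI allI impI)
    show "f x \<bullet> f x + r * (f x \<bullet> c * (f x \<bullet> c)) > 0" if "x \<noteq> 0" for x
      using f0[OF that] \<open>r \<ge> 0\<close> by (simp add: add_pos_nonneg)
  qed (auto intro!: linearI simp: linear_add[OF f(1)] linear_scale[OF f(1)] inner_simps algebra_simps inner_commute)
  show ?thesis
  proof (cases "f u \<bullet> f v = 0")
    case False
    then show ?thesis using ip[of 0] by (intro exI[of _ "\<lambda>x y. f x \<bullet> f y"]) simp
  next
    case True
    show ?thesis
    proof (intro exI conjI)
      show "inner_product (\<lambda>x y. f x \<bullet> f y + 1 * ((f x \<bullet> (f u + f v)) * (f y \<bullet> (f u + f v))))"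
        by (rule ip) simp
      show "f u \<bullet> f v + 1 * ((f u \<bullet> (f u + f v)) * (f v \<bullet> (f u + f v))) \<noteq> 0"
        using True f0[OF assms(3)] f0[OF assms(4)] by (simp add: inner_simps inner_commute)
    qed
  qed
qed

lemma isomorphic_model_admits_strict_CKY:
  fixes br :: "'a::real_vector \<Rightarrow> 'a \<Rightarrow> 'a"
  assumes br: "lie_algebra br" and d: "dim (UNIV :: 'a set) = 4"
    and iso: "lie_isomorphic br m" and m: "m \<in> {h3_R, n4, r3m1_R, euclid2_R}"
  shows "\<exists>ip. inner_product ip \<and> (\<exists>\<omega>. strict_CKY_form br ip 3 \<omega>)"
proof -
  obtain f where f: "linear f" "bij f" "\<And>x y. f (br x y) = m (f x) (f y)"
    using iso by (auto simp: lie_isomorphic_def)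
  obtain c p q where c: "c \<noteq> 0" "\<And>y. m c y = 0" "m p q \<noteq> 0"
    using model_central_nonabelian[OF m] by blast
  have inj: "inj f" and f0: "f 0 = 0" using f(1,2) by (simp_all add: bij_is_inj linear_0)
  obtain u p' q' where u: "f u = c" "f p' = p" "f q' = q"
    using f(2) by (metis bij_pointE)
  have "u \<noteq> 0" using u(1) c(1) f0 by auto
  moreover have "br p' q' \<noteq> 0" using f(3)[of p' q'] u c(3) f0 by auto
  ultimately obtain ip where ip: "inner_product ip" "ip u (br p' q') \<noteq> 0"
    using adapted_inner_product[OF f(1) inj] by blast
  obtain e where e: "orthonormal_frame ip e" "range e = (SOME E. orthonormal_basis ip E)"
    using orthonormal_frame_exists[OF d ip(1)] by blast
  interpret metric_lie_algebra ip e br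
    using e(1) br by (simp add: metric_lie_algebra_def metric_lie_algebra_axioms_def)
  have "br u x = 0" for x
    using f(3)[of u x] u(1) c(2) f0 inj by (metis injD)
  then have "ip (br u x) x = 0" for x by (simp add: bilinear_lzero[OF ip_bilinear])
  then show ?thesis using skew_gives_strict_CKY[OF d e(2) _ ip(2)] ip(1) by blast
qed

theorem proposition4p2:
  fixes br :: "'a::real_vector \<Rightarrow> 'a \<Rightarrow> 'a"
  assumes "lie_algebra br"
    and "dim (UNIV :: 'a set) = 4"
    and "unimodular br"
    and "almost_abelian br"
  shows "(\<exists>ip. inner_product ip \<and> (\<exists>\<omega>. strict_CKY_form br ip 3 \<omega>)) \<longleftrightarrow>
    lie_isomorphic br h3_R \<or> lie_isomorphic br n4 \<or>
    lie_isomorphic br r3m1_R \<or> lie_isomorphic br euclid2_R"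
proof
  assume "\<exists>ip. inner_product ip \<and> (\<exists>\<omega>. strict_CKY_form br ip 3 \<omega>)"
  then obtain ip \<omega> where ip: "inner_product ip" and \<omega>: "strict_CKY_form br ip 3 \<omega>" by blast
  obtain e where e: "orthonormal_frame ip e"
    using orthonormal_frame_exists[OF assms(2) ip] by blast
  interpret metric_lie_algebra ip e br
    using e assms(1) by (simp add: metric_lie_algebra_def metric_lie_algebra_axioms_def)
  obtain \<xi> p q where \<xi>: "\<And>x. ip (br \<xi> x) x = 0" "ip \<xi> (br p q) \<noteq> 0"
    using strict_CKY_gives_skew[OF assms(2,3) \<omega>] by blast
  obtain I where I: "lie_ideal br I" "\<And>x y. x \<in> I \<Longrightarrow> y \<in> I \<Longrightarrow> br x y = 0"
    "dim I + 1 = dim (UNIV :: 'a set)"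
    using assms(4) unfolding almost_abelian_def by blast
  have "\<xi> \<in> I" "\<And>x. br \<xi> x = 0"
    using skew_gives_central[OF assms(2) I \<xi>] by auto
  moreover have "\<xi> \<noteq> 0" "br p q \<noteq> 0"
    using \<xi>(2) bilinear_lzero[OF ip_bilinear] bilinear_rzero[OF ip_bilinear] by auto
  ultimately show "lie_isomorphic br h3_R \<or> lie_isomorphic br n4 \<or>
      lie_isomorphic br r3m1_R \<or> lie_isomorphic br euclid2_R"
    using almost_abelian_classification[OF assms(1,2,3) I] by blast
next
  assume "lie_isomorphic br h3_R \<or> lie_isomorphic br n4 \<or>
    lie_isomorphic br r3m1_R \<or> lie_isomorphic br euclid2_R"
  then show "\<exists>ip. inner_product ip \<and> (\<exists>\<omega>. strict_CKY_form br ip 3 \<omega>)"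
    using isomorphic_model_admits_strict_CKY[OF assms(1,2)] by blast
qed

end
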